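(* Let $H$ be a polycyclic-by-finite group. Then $\nu(H)$ and $H\otimes H$ are polycyclic-by-finite groups.
   Context: A group is polycyclic-by-finite if it has a normal polycyclic subgroup of finite index. Conventions: $x^{y}=y^{-1}xy$ and $[x,y]=x^{-1}y^{-1}xy$. For a group $H$, let $H^{\psi}$ be an isomorphic copy of $H$ via an isomorphism $\psi: h\mapsto h^{\psi}$. The group $\nu(H)$ is $$\nu(H)=\langle H,H^{\psi}\mid [h_1,h_2^{\psi}]^{h_3^{\psi}}=[h_1,h_2^{\psi}]^{h_3}=[h_1^{h_3},(h_2^{h_3})^{\psi}]\ \ \forall h_1,h_2,h_3\in H\rangle,$$ i.e. the quotient of the free product $H*H^{\psi}$ by these relations. The non-commutative (non-abelian) tensor square $H\otimes H$ is the group generated by the symbols $h_1\otimes h_2$ ($h_1,h_2\in H$) subject to the relations $$h_1h_2\otimes h_3=(h_1^{h_2}\otimes h_3^{h_2})(h_2\otimes h_3),\qquad h_1\otimes h_2h_3=(h_1\otimes h_3)(h_1^{h_3}\otimes h_2^{h_3})$$ for all $h_1,h_2,h_3\in H$. *)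

theory Defs
  imports "HOL-Algebra.Elementary_Groups"
begin

section \<open>Polycyclic-by-finite groups\<close>

inductive polycyclic_seq :: "('a, 'b) monoid_scheme \<Rightarrow> 'a set \<Rightarrow> bool"
  for G where
    unity: "polycyclic_seq G {\<one>\<^bsub>G\<^esub>}"
  | extension: "\<lbrakk> polycyclic_seq G K; subgroup H G; K \<lhd> (G \<lparr> carrier := H \<rparr>);
                  cyclic_group ((G \<lparr> carrier := H \<rparr>) Mod K) \<rbrakk> \<Longrightarrow> polycyclic_seq G H"

definition polycyclic :: "('a, 'b) monoid_scheme \<Rightarrow> bool"
  where "polycyclic G \<longleftrightarrow> group G \<and> polycyclic_seq G (carrier G)"

definition polycyclic_by_finite :: "('a, 'b) monoid_scheme \<Rightarrow> bool"
  where "polycyclic_by_finite G \<longleftrightarrow>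
    (\<exists>N. N \<lhd> G \<and> polycyclic (G \<lparr> carrier := N \<rparr>) \<and> finite (rcosets\<^bsub>G\<^esub> N))"


section \<open>Groups given by generators and relations\<close>

text \<open>
  A letter is a generator together with a sign, where \<open>(x, True)\<close> stands for \<open>x\<close> and
  \<open>(x, False)\<close> for the formal inverse of \<open>x\<close>. A relation \<open>u = v\<close> is a pair of words.
\<close>

type_synonym 'g word = "('g \<times> bool) list"

definition words :: "'g set \<Rightarrow> 'g word set"
  where "words S = lists (S \<times> UNIV)"

definition gen :: "'g \<Rightarrow> 'g word"
  where "gen x = [(x, True)]"

definition word_inv :: "'g word \<Rightarrow> 'g word"
  where "word_inv w = rev (map (\<lambda>(x, b). (x, \<not> b)) w)"

definition word_conj :: "'g word \<Rightarrow> 'g word \<Rightarrow> 'g word"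
  where "word_conj u v = word_inv v @ u @ v"

definition word_comm :: "'g word \<Rightarrow> 'g word \<Rightarrow> 'g word"
  where "word_comm u v = word_inv u @ word_inv v @ u @ v"

inductive word_cong :: "'g set \<Rightarrow> ('g word \<times> 'g word) set \<Rightarrow> 'g word \<Rightarrow> 'g word \<Rightarrow> bool"
  for S R where
    refl: "w \<in> words S \<Longrightarrow> word_cong S R w w"
  | sym: "word_cong S R u v \<Longrightarrow> word_cong S R v u"
  | trans: "\<lbrakk> word_cong S R u v; word_cong S R v w \<rbrakk> \<Longrightarrow> word_cong S R u w"
  | append: "\<lbrakk> word_cong S R u u'; word_cong S R v v' \<rbrakk> \<Longrightarrow> word_cong S R (u @ v) (u' @ v')"
  | cancel: "x \<in> S \<Longrightarrow> word_cong S R [(x, b), (x, \<not> b)] []"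
  | relation: "\<lbrakk> (u, v) \<in> R; u \<in> words S; v \<in> words S \<rbrakk> \<Longrightarrow> word_cong S R u v"

definition word_rel :: "'g set \<Rightarrow> ('g word \<times> 'g word) set \<Rightarrow> ('g word \<times> 'g word) set"
  where "word_rel S R = {(u, v). word_cong S R u v}"

definition presented_group :: "'g set \<Rightarrow> ('g word \<times> 'g word) set \<Rightarrow> 'g word set monoid"
  where "presented_group S R =
    \<lparr> carrier = words S // word_rel S R,
      monoid.mult = (\<lambda>A B. \<Union>u\<in>A. \<Union>v\<in>B. word_rel S R `` {u @ v}),
      one = word_rel S R `` {[]} \<rparr>"

lemma words_Nil [simp]: "[] \<in> words S"
  by (simp add: words_def)

lemma words_append [simp]: "u @ v \<in> words S \<longleftrightarrow> u \<in> words S \<and> v \<in> words S"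
  by (auto simp: words_def)

lemma words_Cons [simp]: "(x, b) # w \<in> words S \<longleftrightarrow> x \<in> S \<and> w \<in> words S"
  by (auto simp: words_def)

lemma words_word_inv [simp]: "word_inv w \<in> words S \<longleftrightarrow> w \<in> words S"
  by (induction w) (auto simp: word_inv_def)

lemma word_cong_words: "word_cong S R u v \<Longrightarrow> u \<in> words S \<and> v \<in> words S"
  by (induction rule: word_cong.induct) auto

lemma equiv_word_rel: "equiv (words S) (word_rel S R)"
  by (rule equivI)
    (auto simp: word_rel_def refl_on_def sym_def trans_def
      dest: word_cong_words intro: word_cong.refl word_cong.sym word_cong.trans)

lemma word_cong_left_inv:
  assumes "w \<in> words S"
  shows "word_cong S R (word_inv w @ w) []"
  using assms
proof (induction w)
  case Nil
  then show ?case by (simp add: word_inv_def word_cong.refl)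
next
  case (Cons a w)
  obtain x b where a: "a = (x, b)" by (cases a)
  have x: "x \<in> S" and w: "w \<in> words S" using Cons.prems a by auto
  have "word_cong S R (word_inv w @ [(x, \<not> b), (x, b)] @ w) (word_inv w @ [] @ w)"
    using word_cong.cancel[OF x, of R "\<not> b"] w
    by (intro word_cong.append word_cong.refl) auto
  then show ?case
    using Cons.IH[OF w] by (auto simp: a word_inv_def intro: word_cong.trans)
qed

lemma presented_group_mult_class:
  assumes "u \<in> words S" "v \<in> words S"
  shows "(word_rel S R `` {u}) \<otimes>\<^bsub>presented_group S R\<^esub> (word_rel S R `` {v}) = word_rel S R `` {u @ v}"
proof -
  have "(\<lambda>u v. word_rel S R `` {u @ v}) respects2 word_rel S R"
    unfolding congruent2_def
    by (auto simp: word_rel_def intro: word_cong.append word_cong.sym word_cong.trans)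
  then show ?thesis
    using UN_equiv_class2[OF equiv_word_rel equiv_word_rel _ assms]
    by (simp add: presented_group_def)
qed

lemma group_presented_group: "group (presented_group S R)"
proof (rule groupI)
  let ?G = "presented_group S R" and ?c = "\<lambda>w. word_rel S R `` {w}"
  have car: "A \<in> carrier ?G \<longleftrightarrow> (\<exists>u\<in>words S. A = ?c u)" for A
    by (auto simp: presented_group_def quotient_def)
  have one: "\<one>\<^bsub>?G\<^esub> = ?c []"
    by (simp add: presented_group_def)
  show "\<one>\<^bsub>?G\<^esub> \<in> carrier ?G"
    unfolding car one by auto
  fix A assume "A \<in> carrier ?G"
  then obtain u where u: "u \<in> words S" "A = ?c u" unfolding car by blast
  show "\<one>\<^bsub>?G\<^esub> \<otimes>\<^bsub>?G\<^esub> A = A"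
    using u by (simp add: one presented_group_mult_class)
  have "?c (word_inv u @ u) = ?c []"
    using word_cong_left_inv[OF u(1)] by (intro equiv_class_eq[OF equiv_word_rel]) (simp add: word_rel_def)
  then show "\<exists>B\<in>carrier ?G. B \<otimes>\<^bsub>?G\<^esub> A = \<one>\<^bsub>?G\<^esub>"
    using u by (intro bexI[of _ "?c (word_inv u)"]) (auto simp: one presented_group_mult_class car)
  fix B assume "B \<in> carrier ?G"
  then obtain v where v: "v \<in> words S" "B = ?c v" unfolding car by blast
  show "A \<otimes>\<^bsub>?G\<^esub> B \<in> carrier ?G"
    using u v by (auto simp: presented_group_mult_class car)
  fix C assume "C \<in> carrier ?G"
  then obtain w where w: "w \<in> words S" "C = ?c w" unfolding car by blast
  show "A \<otimes>\<^bsub>?G\<^esub> B \<otimes>\<^bsub>?G\<^esub> C = A \<otimes>\<^bsub>?G\<^esub> (B \<otimes>\<^bsub>?G\<^esub> C)"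
    using u v w by (simp add: presented_group_mult_class)
qed


section \<open>The group \<open>\<nu>(H)\<close> and the non-abelian tensor square\<close>

definition gconj :: "('a, 'b) monoid_scheme \<Rightarrow> 'a \<Rightarrow> 'a \<Rightarrow> 'a"
  where "gconj H x y = inv\<^bsub>H\<^esub> y \<otimes>\<^bsub>H\<^esub> x \<otimes>\<^bsub>H\<^esub> y"

text \<open>
  The generator \<open>Inl h\<close> is \<open>h\<close> and \<open>Inr h\<close> is \<open>h\<^sup>\<psi>\<close>. The relations \<open>free_product_relations H\<close>
  are the multiplication tables of the two copies of \<open>H\<close>, so that they present the free
  product of \<open>H\<close> and \<open>H\<^sup>\<psi>\<close>.
\<close>

abbreviation left_gen :: "'a \<Rightarrow> ('a + 'a) word"
  where "left_gen h \<equiv> gen (Inl h)"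

abbreviation psi_gen :: "'a \<Rightarrow> ('a + 'a) word"
  where "psi_gen h \<equiv> gen (Inr h)"

definition free_product_relations ::
  "('a, 'b) monoid_scheme \<Rightarrow> (('a + 'a) word \<times> ('a + 'a) word) set"
  where "free_product_relations H =
    {(left_gen (a \<otimes>\<^bsub>H\<^esub> b), left_gen a @ left_gen b) | a b. a \<in> carrier H \<and> b \<in> carrier H} \<union>
    {(psi_gen (a \<otimes>\<^bsub>H\<^esub> b), psi_gen a @ psi_gen b) | a b. a \<in> carrier H \<and> b \<in> carrier H}"

definition nu_relations ::
  "('a, 'b) monoid_scheme \<Rightarrow> (('a + 'a) word \<times> ('a + 'a) word) set"
  where "nu_relations H =
    {(word_conj (word_comm (left_gen h1) (psi_gen h2)) (psi_gen h3),
      word_conj (word_comm (left_gen h1) (psi_gen h2)) (left_gen h3))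
     | h1 h2 h3. h1 \<in> carrier H \<and> h2 \<in> carrier H \<and> h3 \<in> carrier H} \<union>
    {(word_conj (word_comm (left_gen h1) (psi_gen h2)) (left_gen h3),
      word_comm (left_gen (gconj H h1 h3)) (psi_gen (gconj H h2 h3)))
     | h1 h2 h3. h1 \<in> carrier H \<and> h2 \<in> carrier H \<and> h3 \<in> carrier H}"

definition nu_group :: "('a, 'b) monoid_scheme \<Rightarrow> ('a + 'a) word set monoid"
  where "nu_group H =
    presented_group (Inl ` carrier H \<union> Inr ` carrier H) (free_product_relations H \<union> nu_relations H)"

definition tensor_relations ::
  "('a, 'b) monoid_scheme \<Rightarrow> (('a \<times> 'a) word \<times> ('a \<times> 'a) word) set"
  where "tensor_relations H =
    {(gen (h1 \<otimes>\<^bsub>H\<^esub> h2, h3), gen (gconj H h1 h2, gconj H h3 h2) @ gen (h2, h3))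
     | h1 h2 h3. h1 \<in> carrier H \<and> h2 \<in> carrier H \<and> h3 \<in> carrier H} \<union>
    {(gen (h1, h2 \<otimes>\<^bsub>H\<^esub> h3), gen (h1, h3) @ gen (gconj H h1 h3, gconj H h2 h3))
     | h1 h2 h3. h1 \<in> carrier H \<and> h2 \<in> carrier H \<and> h3 \<in> carrier H}"

definition tensor_square :: "('a, 'b) monoid_scheme \<Rightarrow> ('a \<times> 'a) word set monoid"
  where "tensor_square H = presented_group (carrier H \<times> carrier H) (tensor_relations H)"

end

theory Submission
  imports Defs
begin

text \<open>
  Let \<open>H\<close> be polycyclic-by-finite. Both results come from one principle
  (\<open>polycyclic_by_finite_if_central_kernel\<close>): a finitely generated group \<open>G\<close> is polycyclic-by-finite as
  soon as it has finitely many homomorphisms into a polycyclic-by-finite group whose common kernel is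
  central. Indeed, a subgroup \<open>T\<close> of finite index in \<open>G\<close> is polycyclic modulo the central kernel; it is
  finitely generated by Schreier's argument; and a finitely generated central-by-polycyclic group is
  polycyclic (\<open>finitely_generated_central_extension\<close>).

  For the tensor square the homomorphism is the commutator map \<open>\<kappa>\<close> from \<open>H \<otimes> H\<close> to \<open>H\<close>, which sends
  \<open>x \<otimes> y\<close> to \<open>[x, y]\<close>. The group \<open>H\<close> acts on \<open>H \<otimes> H\<close> by conjugating both arguments, and two identities
  hold: \<open>t\<inverse> s t\<close> is the image of \<open>s\<close> under \<open>\<kappa> t\<close> (\<open>peiffer\<close>), and the image of \<open>t\<close> under \<open>h\<close> is
  \<open>t (\<kappa> t \<otimes> h)\<close> (\<open>act_eq\<close>). So the kernel of \<open>\<kappa>\<close> is central and is fixed pointwise by \<open>H\<close>. The second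
  property also gives finite generation of \<open>H \<otimes> H\<close>: subgroups of \<open>H\<close> are finitely generated, so finitely
  many elements generate \<open>H \<otimes> H\<close> modulo the kernel, and their span becomes invariant under \<open>H\<close> after
  finitely many elements of the kernel are adjoined.

  For \<open>\<nu>(H)\<close>, which is generated by two copies of \<open>H\<close>, there are three homomorphisms to \<open>H\<close>: the two
  projections and the map that is the identity on both copies. An element of the
  common kernel of the projections is a product of commutators between the copies and their inverses,
  hence the image of some \<open>t\<close> in \<open>H \<otimes> H\<close>. If the third map also kills it, then \<open>\<kappa> t = \<one>\<close>, and as \<open>H\<close>
  fixes \<open>t\<close> the element commutes with both copies. So the common kernel is again central.
\<close>

section \<open>Cyclic extensions\<close>

lemma (in group) cancel_left [simp]:
  assumes "x \<in> carrier G" "y \<in> carrier G"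
  shows "x \<otimes> (inv x \<otimes> y) = y" "inv x \<otimes> (x \<otimes> y) = y"
  using assms by (simp_all add: m_assoc [symmetric])

lemma (in group) generate_insert_generate:
  assumes "X \<subseteq> carrier G" "t \<in> carrier G"
  shows "generate G (insert t (generate G X)) = generate G (insert t X)"
proof
  have "subgroup (generate G (insert t X)) G"
    using assms by (intro generate_is_subgroup) auto
  moreover have "generate G X \<subseteq> generate G (insert t X)"
    by (rule mono_generate) auto
  ultimately show "generate G (insert t (generate G X)) \<subseteq> generate G (insert t X)"
    by (intro generate_subgroup_incl) (auto intro: generate.incl)
  show "generate G (insert t X) \<subseteq> generate G (insert t (generate G X))"
    by (rule mono_generate) (auto intro: generate.incl)
qed

text \<open>
  All groups of a series are kept as subsets of one ambient group, and cyclicity of the quotient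
  \<open>T/K\<close> is expressed by cosets of powers of one element. This avoids towers of quotient
  groups of quotient groups when series are pulled back, intersected or concatenated.
\<close>

definition cyclic_extension :: "('a, 'b) monoid_scheme \<Rightarrow> 'a set \<Rightarrow> 'a set \<Rightarrow> bool"
  where "cyclic_extension G K T \<longleftrightarrow> subgroup K G \<and> subgroup T G \<and> K \<subseteq> T \<and>
    (\<forall>g\<in>T. \<forall>k\<in>K. g \<otimes>\<^bsub>G\<^esub> k \<otimes>\<^bsub>G\<^esub> inv\<^bsub>G\<^esub> g \<in> K) \<and>
    (\<exists>t\<in>T. \<forall>g\<in>T. \<exists>n::int. g \<in> K #>\<^bsub>G\<^esub> t [^]\<^bsub>G\<^esub> n)"

lemma cyclic_extensionD:
  assumes "cyclic_extension G K T"
  shows "subgroup K G" "subgroup T G" "K \<subseteq> T"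
    and "\<And>g k. g \<in> T \<Longrightarrow> k \<in> K \<Longrightarrow> g \<otimes>\<^bsub>G\<^esub> k \<otimes>\<^bsub>G\<^esub> inv\<^bsub>G\<^esub> g \<in> K"
  using assms by (simp_all add: cyclic_extension_def)

lemma cyclic_extension_generator:
  assumes "cyclic_extension G K T"
  obtains t where "t \<in> T" "\<And>g. g \<in> T \<Longrightarrow> \<exists>n::int. g \<in> K #>\<^bsub>G\<^esub> t [^]\<^bsub>G\<^esub> n"
  using assms by (auto simp: cyclic_extension_def)

lemma cyclic_extensionI:
  assumes "subgroup K G" "subgroup T G" "K \<subseteq> T"
    and "\<And>g k. g \<in> T \<Longrightarrow> k \<in> K \<Longrightarrow> g \<otimes>\<^bsub>G\<^esub> k \<otimes>\<^bsub>G\<^esub> inv\<^bsub>G\<^esub> g \<in> K"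
    and "t \<in> T" "\<And>g. g \<in> T \<Longrightarrow> \<exists>n::int. g \<in> K #>\<^bsub>G\<^esub> t [^]\<^bsub>G\<^esub> n"
  shows "cyclic_extension G K T"
  unfolding cyclic_extension_def using assms(1-4) assms(6) by (intro conjI bexI[OF _ assms(5)]) simp_all

lemma (in group) cyclic_extension_iff_cyclic_quotient:
  assumes "subgroup K G"
  shows "cyclic_extension G K T \<longleftrightarrow>
    subgroup T G \<and> K \<lhd> (G \<lparr> carrier := T \<rparr>) \<and> cyclic_group ((G \<lparr> carrier := T \<rparr>) Mod K)"
proof (cases "subgroup T G \<and> K \<subseteq> T")
  case True
  let ?Q = "G \<lparr> carrier := T \<rparr>"
  have T: "subgroup T G" "K \<subseteq> T" using True by auto
  interpret Q: group ?Q using subgroup.subgroup_is_group[OF T(1)] group_axioms by auto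
  have K: "subgroup K ?Q" using subgroup_incl[OF assms T(1) T(2)] .
  have nor: "K \<lhd> ?Q \<longleftrightarrow> (\<forall>g\<in>T. \<forall>k\<in>K. g \<otimes> k \<otimes> inv g \<in> K)"
    unfolding Q.normal_inv_iff using K T(1) by simp
  have "cyclic_group (?Q Mod K) \<longleftrightarrow> (\<exists>t\<in>T. \<forall>g\<in>T. \<exists>n::int. g \<in> K #> t [^] n)"
    if n: "K \<lhd> ?Q"
  proof -
    interpret N: normal K ?Q by (rule n)
    interpret M: group "?Q Mod K" by (rule N.factorgroup_is_group)
    have pw: "(K #>\<^bsub>?Q\<^esub> t) [^]\<^bsub>?Q Mod K\<^esub> (n::int) = K #> t [^] n" if "t \<in> T" for t n
      using N.FactGroup_int_pow[of t n] that int_pow_consistent[OF T(1) that, of n] by simp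
    have rng: "range (\<lambda>n::int. (K #>\<^bsub>?Q\<^esub> t) [^]\<^bsub>?Q Mod K\<^esub> n) = range (\<lambda>n::int. K #> t [^] n)"
      if "t \<in> T" for t
      by (rule image_cong[OF HOL.refl pw[OF that]])
    have "cyclic_group (?Q Mod K) \<longleftrightarrow>
      (\<exists>t\<in>T. (\<lambda>g. K #> g) ` T = range (\<lambda>n::int. K #> t [^] n))"
      unfolding M.cyclic_group carrier_FactGroup using rng by auto
    also have "\<dots> \<longleftrightarrow> (\<exists>t\<in>T. \<forall>g\<in>T. \<exists>n::int. g \<in> K #> t [^] n)"
    proof (intro bex_cong HOL.refl)
      fix t assume t: "t \<in> T"
      have tn: "t [^] (n::int) \<in> T" for n by (rule subgroup_int_pow_closed[OF T(1) t])
      have T_sub: "T \<subseteq> carrier G" using T(1) by (rule subgroup.subset)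
      have *: "K #> g = K #> t [^] n \<longleftrightarrow> g \<in> K #> t [^] n" if "g \<in> T" for g and n :: int
      proof
        show "g \<in> K #> t [^] n" if "K #> g = K #> t [^] n"
          using repr_independenceD[OF assms, of g "t [^] n"] that \<open>g \<in> T\<close> T_sub by auto
        show "K #> g = K #> t [^] n" if "g \<in> K #> t [^] n"
          using repr_independence[OF that _ assms] tn[of n] T_sub by auto
      qed
      have "(\<lambda>g. K #> g) ` T = range (\<lambda>n::int. K #> t [^] n) \<longleftrightarrow>
        (\<forall>g\<in>T. \<exists>n::int. K #> g = K #> t [^] n)"
      proof -
        have "range (\<lambda>n::int. K #> t [^] n) \<subseteq> (\<lambda>g. K #> g) ` T"
          using tn by (intro image_subsetI imageI)
        then have "(\<lambda>g. K #> g) ` T = range (\<lambda>n::int. K #> t [^] n) \<longleftrightarrow>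
          (\<lambda>g. K #> g) ` T \<subseteq> range (\<lambda>n::int. K #> t [^] n)"
          by (simp add: set_eq_subset)
        then show ?thesis
          by (simp add: image_subset_iff image_iff)
      qed
      then show "(\<lambda>g. K #> g) ` T = range (\<lambda>n::int. K #> t [^] n) \<longleftrightarrow>
        (\<forall>g\<in>T. \<exists>n::int. g \<in> K #> t [^] n)"
        using * by auto
    qed
    finally show ?thesis .
  qed
  then show ?thesis
    unfolding cyclic_extension_def using assms T nor by auto
next
  case False
  moreover have "K \<lhd> (G \<lparr> carrier := T \<rparr>) \<Longrightarrow> K \<subseteq> T"
    using subgroup.subset[OF normal_imp_subgroup] by fastforce
  ultimately show ?thesis by (auto simp: cyclic_extension_def)
qed

text \<open>
  When powers of \<open>t\<close> normalise \<open>K\<close>, the cosets \<open>K t\<^sup>n\<close> multiply like the integers \<open>n\<close>. This and the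
  next two facts replace computations in the quotient by \<open>K\<close>.
\<close>

lemma (in group) power_coset_mult:
  fixes p q :: int
  assumes K: "subgroup K G" and t: "t \<in> carrier G"
    and nor: "\<And>k n. k \<in> K \<Longrightarrow> t [^] (n::int) \<otimes> k \<otimes> inv (t [^] n) \<in> K"
    and x: "x \<in> K #> t [^] p" and y: "y \<in> K #> t [^] q"
  shows "x \<otimes> y \<in> K #> t [^] (p + q)"
proof -
  obtain k l where kl: "k \<in> K" "x = k \<otimes> t [^] p" "l \<in> K" "y = l \<otimes> t [^] q"
    using x y unfolding r_coset_def by blast
  have c: "k \<in> carrier G" "l \<in> carrier G" using kl(1,3) by (simp_all add: subgroup.mem_carrier[OF K])
  have "x \<otimes> y = k \<otimes> (t [^] p \<otimes> l \<otimes> inv (t [^] p)) \<otimes> t [^] (p + q)"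
    using c t kl by (simp add: m_assoc int_pow_mult)
  moreover have "k \<otimes> (t [^] p \<otimes> l \<otimes> inv (t [^] p)) \<in> K"
    using nor kl K by (auto intro: subgroup.m_closed)
  ultimately show ?thesis by (auto simp: r_coset_def)
qed

lemma (in group) power_coset_inv:
  fixes p :: int
  assumes K: "subgroup K G" and t: "t \<in> carrier G"
    and nor: "\<And>k n. k \<in> K \<Longrightarrow> t [^] (n::int) \<otimes> k \<otimes> inv (t [^] n) \<in> K"
    and x: "x \<in> K #> t [^] p"
  shows "inv x \<in> K #> t [^] (- p)"
proof -
  obtain k where k: "k \<in> K" "x = k \<otimes> t [^] p"
    using x unfolding r_coset_def by blast
  have c: "k \<in> carrier G" using k(1) by (rule subgroup.mem_carrier[OF K])
  have "inv x = (t [^] (- p) \<otimes> inv k \<otimes> inv (t [^] (- p))) \<otimes> t [^] (- p)"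
    using c t k by (simp add: m_assoc inv_mult_group int_pow_neg)
  moreover have "t [^] (- p) \<otimes> inv k \<otimes> inv (t [^] (- p)) \<in> K"
    using nor k K by (auto intro: subgroup.m_inv_closed)
  ultimately show ?thesis by (auto simp: r_coset_def)
qed

lemma (in group) power_coset_pow:
  fixes p n :: int
  assumes K: "subgroup K G" and t: "t \<in> carrier G"
    and nor: "\<And>k n. k \<in> K \<Longrightarrow> t [^] (n::int) \<otimes> k \<otimes> inv (t [^] n) \<in> K"
    and x: "x \<in> K #> t [^] p"
  shows "x [^] n \<in> K #> t [^] (p * n)"
proof -
  have xc: "x \<in> carrier G"
    using x K t r_coset_subset_G[of K "t [^] p"] subgroup.subset by blast
  have nat: "x [^] (int m) \<in> K #> t [^] (p * int m)" for m
  proof (induction m)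
    case 0
    then show ?case using K by (simp add: subgroup.subset subgroup.one_closed)
  next
    case (Suc m)
    then show ?case
      using power_coset_mult[OF K t nor Suc x] xc int_pow_mult[of x "int m" 1]
      by (simp add: algebra_simps)
  qed
  show ?thesis
  proof (cases n rule: int_cases2)
    case (nonneg m) then show ?thesis using nat by simp
  next
    case (nonpos m)
    then show ?thesis
      using power_coset_inv[OF K t nor nat[of m]] xc by (simp add: int_pow_neg)
  qed
qed

lemma int_subgroup_generator:
  fixes I :: "int set"
  assumes zero: "0 \<in> I" and diff: "\<And>m n. m \<in> I \<Longrightarrow> n \<in> I \<Longrightarrow> m - n \<in> I"
  obtains d where "d \<in> I" "\<And>n. n \<in> I \<Longrightarrow> d dvd n"
proof (cases "\<exists>n\<in>I. n > 0")
  case False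
  then have "n = 0" if "n \<in> I" for n
    using that diff[OF zero that] by (metis diff_0 linorder_neqE_linordered_idom neg_0_less_iff_less)
  then show ?thesis using that[of 0] zero by auto
next
  case True
  define d where "d = (LEAST n::nat. n > 0 \<and> int n \<in> I)"
  have ex: "\<exists>n::nat. n > 0 \<and> int n \<in> I"
    using True by (metis int_nat_eq order_less_imp_le zero_less_nat_eq)
  have d: "d > 0" "int d \<in> I"
    using LeastI_ex[OF ex] unfolding d_def by auto
  have mult: "m \<in> I \<Longrightarrow> m - int d * int k \<in> I" for m k
  proof (induction k)
    case (Suc k)
    then show ?case using diff[OF Suc.IH[OF Suc.prems] d(2)] by (simp add: algebra_simps)
  qed simp
  have "int d dvd n" if n: "n \<in> I" for n
  proof -
    have neg: "- n \<in> I" using diff[OF zero n] by simp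
    have "n mod int d \<in> I"
    proof (cases "n \<ge> 0")
      case True
      then show ?thesis
        using mult[OF n, of "nat (n div int d)"] d(1)
        by (simp add: minus_mult_div_eq_mod pos_imp_zdiv_nonneg_iff)
    next
      case False
      have "- n - int d * (- (n div int d)) \<in> I"
        using mult[OF neg, of "nat (- (n div int d))"] False d(1)
        by (simp add: pos_imp_zdiv_neg_iff order_less_imp_le)
      then have "- (n mod int d) \<in> I"
        by (simp add: minus_mult_div_eq_mod [symmetric])
      then show ?thesis using diff[OF zero] by fastforce
    qed
    moreover have "0 \<le> n mod int d" "n mod int d < int d" using d(1) by auto
    moreover have "\<not> (0 < k \<and> int k \<in> I)" if "k < d" for k
      using not_less_Least that unfolding d_def by blast
    ultimately have "n mod int d = 0"
      by (metis int_nat_eq nat_less_iff order_le_imp_less_or_eq zero_less_nat_eq)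
    then show ?thesis by auto
  qed
  then show ?thesis using that d(2) by blast
qed

text \<open>
  The quotient of \<open>T\<close> by the preimage of \<open>K\<close> embeds into \<open>S/K\<close>, and subgroups of cyclic groups
  are cyclic. Concretely, the exponents \<open>n\<close> for which \<open>h\<close> maps some element of \<open>T\<close> into \<open>K t\<^sup>n\<close> form
  a subgroup \<open>I\<close> of the integers; an element of \<open>T\<close> that realises a generator of \<open>I\<close> generates \<open>T\<close>
  modulo the preimage.
\<close>

lemma (in group_hom) cyclic_extension_pullback:
  assumes ext: "cyclic_extension H K S" and T: "subgroup T G" and sub: "h ` T \<subseteq> S"
  shows "cyclic_extension G {g \<in> T. h g \<in> K} T"
proof -
  note K = cyclic_extensionD(1)[OF ext] and S = cyclic_extensionD(2,3)[OF ext]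
    and nor = cyclic_extensionD(4)[OF ext]
  obtain t where t: "t \<in> S" "\<And>g. g \<in> S \<Longrightarrow> \<exists>n::int. g \<in> K #>\<^bsub>H\<^esub> t [^]\<^bsub>H\<^esub> n"
    using cyclic_extension_generator[OF ext] by metis
  let ?L = "{g \<in> T. h g \<in> K}"
  have Tc: "g \<in> carrier G" if "g \<in> T" for g using that subgroup.mem_carrier[OF T] by blast
  have Kc: "K \<subseteq> carrier H" using K by (rule subgroup.subset)
  have tc: "t \<in> carrier H" using t(1) by (rule subgroup.mem_carrier[OF S(1)])
  have nort: "t [^]\<^bsub>H\<^esub> (n::int) \<otimes>\<^bsub>H\<^esub> k \<otimes>\<^bsub>H\<^esub> inv\<^bsub>H\<^esub> (t [^]\<^bsub>H\<^esub> n) \<in> K" if "k \<in> K" for k n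
    by (rule nor[OF H.subgroup_int_pow_closed[OF S(1) t(1)] that])
  have L: "subgroup ?L G"
  proof (rule G.subgroupI)
    have "\<one>\<^bsub>G\<^esub> \<in> ?L" using T K by (simp add: subgroup.one_closed)
    then show "?L \<noteq> {}" by blast
  qed (use T K Tc in \<open>auto simp: subgroup.m_closed subgroup.m_inv_closed\<close>)
  have norL: "g \<otimes> k \<otimes> inv g \<in> ?L" if "g \<in> T" "k \<in> ?L" for g k
    using that nor[of "h g" "h k"] sub T Tc
    by (auto simp: subgroup.m_closed subgroup.m_inv_closed)
  define I where "I = {n::int. \<exists>g\<in>T. h g \<in> K #>\<^bsub>H\<^esub> t [^]\<^bsub>H\<^esub> n}"
  have "0 \<in> I"
    unfolding I_def using T K Kc by (auto simp: subgroup.one_closed intro!: bexI[of _ \<one>])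
  moreover have "m - n \<in> I" if mn: "m \<in> I" "n \<in> I" for m n
  proof -
    obtain g g' where g: "g \<in> T" "h g \<in> K #>\<^bsub>H\<^esub> t [^]\<^bsub>H\<^esub> m" "g' \<in> T" "h g' \<in> K #>\<^bsub>H\<^esub> t [^]\<^bsub>H\<^esub> n"
      using mn unfolding I_def by blast
    have "h (g \<otimes> inv g') \<in> K #>\<^bsub>H\<^esub> t [^]\<^bsub>H\<^esub> (m - n)"
      using H.power_coset_mult[OF K tc nort g(2) H.power_coset_inv[OF K tc nort g(4)]] Tc g
      by simp
    then show ?thesis
      unfolding I_def using g T by (auto intro: subgroup.m_closed subgroup.m_inv_closed)
  qed
  ultimately obtain d where d: "d \<in> I" "\<And>n. n \<in> I \<Longrightarrow> d dvd n"
    using int_subgroup_generator by metis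
  obtain s where s: "s \<in> T" "h s \<in> K #>\<^bsub>H\<^esub> t [^]\<^bsub>H\<^esub> d" using d(1) unfolding I_def by blast
  have "\<exists>n::int. g \<in> ?L #> s [^] n" if g: "g \<in> T" for g
  proof -
    obtain m :: int where m: "h g \<in> K #>\<^bsub>H\<^esub> t [^]\<^bsub>H\<^esub> m" using t(2) sub g by blast
    then obtain n where n: "m = d * n" using d(2) g unfolding I_def by blast
    have "h (g \<otimes> inv (s [^] n)) \<in> K #>\<^bsub>H\<^esub> t [^]\<^bsub>H\<^esub> (m - d * n)"
      using H.power_coset_mult[OF K tc nort m
          H.power_coset_inv[OF K tc nort H.power_coset_pow[OF K tc nort s(2)]]] Tc g s
      by (simp add: hom_int_pow)
    then have "h (g \<otimes> inv (s [^] n)) \<in> K" using n Kc by simp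
    then have "g \<otimes> inv (s [^] n) \<in> ?L"
      using g s T by (auto intro: subgroup.m_closed subgroup.m_inv_closed G.subgroup_int_pow_closed)
    then show ?thesis
      using subgroup.rcos_module_rev[OF L G.group_axioms] Tc g s by blast
  qed
  then show ?thesis
    using s(1) by (intro cyclic_extensionI[OF L T _ norL]) auto
qed

lemma (in group) cyclic_extension_insert:
  assumes M: "subgroup M G" and t: "t \<in> carrier G"
    and nor: "\<And>m. m \<in> M \<Longrightarrow> t \<otimes> m \<otimes> inv t \<in> M" "\<And>m. m \<in> M \<Longrightarrow> inv t \<otimes> m \<otimes> t \<in> M"
  shows "cyclic_extension G M (generate G (insert t M))"
proof -
  let ?T = "generate G (insert t M)"
  have Mc: "M \<subseteq> carrier G" using M by (rule subgroup.subset)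
  then have sub: "insert t M \<subseteq> carrier G" using t by blast
  have T: "subgroup ?T G" by (rule generate_is_subgroup[OF sub])
  have gc: "g \<in> carrier G" if "g \<in> ?T" for g using that by (rule subgroup.mem_carrier[OF T])
  have nor_gen: "(\<forall>m\<in>M. g \<otimes> m \<otimes> inv g \<in> M) \<and> (\<forall>m\<in>M. inv g \<otimes> m \<otimes> g \<in> M)"
    if "g \<in> insert t M" for g
    using that nor M by (auto intro: subgroup.m_closed subgroup.m_inv_closed)
  have norT: "(\<forall>m\<in>M. g \<otimes> m \<otimes> inv g \<in> M) \<and> (\<forall>m\<in>M. inv g \<otimes> m \<otimes> g \<in> M)" if "g \<in> ?T" for g
    using that
  proof (induction rule: generate.induct)
    case one then show ?case using Mc by auto
  next
    case (incl g) then show ?case by (rule nor_gen)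
  next
    case (inv g)
    then have "inv (inv g) = g" using sub by auto
    then show ?case using nor_gen[OF inv] by simp
  next
    case (eng g g')
    have *: "(g \<otimes> g') \<otimes> m \<otimes> inv (g \<otimes> g') = g \<otimes> (g' \<otimes> m \<otimes> inv g') \<otimes> inv g"
      "inv (g \<otimes> g') \<otimes> m \<otimes> (g \<otimes> g') = inv g' \<otimes> (inv g \<otimes> m \<otimes> g) \<otimes> g'" if "m \<in> M" for m
      using gc[OF eng(1)] gc[OF eng(2)] that Mc by (auto simp: m_assoc inv_mult_group subset_iff)
    show ?case using eng by (auto simp: *)
  qed
  have tT: "t \<in> ?T" by (auto intro: generate.incl)
  have nort: "t [^] (n::int) \<otimes> k \<otimes> inv (t [^] n) \<in> M" if "k \<in> M" for k n
    using norT[OF subgroup_int_pow_closed[OF T tT]] that by simp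
  have cM: "m \<in> M #> t [^] (0::int)" if "m \<in> M" for m
    using that Mc by simp
  have ct: "t \<in> M #> t [^] (1::int)"
    using rcos_self[OF t M] t by simp
  have "\<exists>n::int. g \<in> M #> t [^] n" if "g \<in> ?T" for g
    using that
  proof (induction rule: generate.induct)
    case one then show ?case using cM[OF subgroup.one_closed[OF M]] by blast
  next
    case (incl g) then show ?case using cM ct by blast
  next
    case (inv g) then show ?case
      using cM[OF subgroup.m_inv_closed[OF M]] power_coset_inv[OF M t nort ct] by blast
  next
    case (eng g g') then show ?case using power_coset_mult[OF M t nort] by blast
  qed
  moreover have "M \<subseteq> ?T" by (auto intro: generate.incl)
  ultimately show ?thesis
    using norT tT by (intro cyclic_extensionI[OF M T]) auto
qed

section \<open>Relative polycyclic series\<close>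

text \<open>
  A series with cyclic factors that starts at an arbitrary subgroup \<open>A\<close>. The relative notion
  makes it possible to speak of being polycyclic modulo a kernel without forming the quotient.
\<close>

inductive relative_polycyclic :: "('a, 'b) monoid_scheme \<Rightarrow> 'a set \<Rightarrow> 'a set \<Rightarrow> bool"
  for G A where
    base: "subgroup A G \<Longrightarrow> relative_polycyclic G A A"
  | step: "relative_polycyclic G A K \<Longrightarrow> cyclic_extension G K T \<Longrightarrow> relative_polycyclic G A T"

lemma relative_polycyclic_subgroups:
  "relative_polycyclic G A T \<Longrightarrow> subgroup A G \<and> subgroup T G \<and> A \<subseteq> T"
  by (induction rule: relative_polycyclic.induct) (auto simp: cyclic_extension_def)

lemma relative_polycyclic_trans:
  "relative_polycyclic G B T \<Longrightarrow> relative_polycyclic G A B \<Longrightarrow> relative_polycyclic G A T"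
  by (induction rule: relative_polycyclic.induct) (auto intro: relative_polycyclic.step)

lemma (in group) polycyclic_seq_iff_relative:
  "polycyclic_seq G T \<longleftrightarrow> relative_polycyclic G {\<one>} T"
proof
  assume "polycyclic_seq G T"
  then show "relative_polycyclic G {\<one>} T"
  proof (induction rule: polycyclic_seq.induct)
    case unity
    then show ?case by (intro relative_polycyclic.base triv_subgroup)
  next
    case (extension K T)
    then show ?case
      using cyclic_extension_iff_cyclic_quotient[of K T] relative_polycyclic_subgroups
      by (blast intro: relative_polycyclic.step)
  qed
next
  assume "relative_polycyclic G {\<one>} T"
  then show "polycyclic_seq G T"
  proof (induction rule: relative_polycyclic.induct)
    case base
    show ?case by (rule polycyclic_seq.unity)
  next
    case (step K T)
    then have "subgroup K G" by (simp add: cyclic_extension_def)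
    then show ?case
      using step cyclic_extension_iff_cyclic_quotient[of K T] polycyclic_seq.extension by blast
  qed
qed

lemma (in group) relative_polycyclic_in_subgroup:
  assumes N: "subgroup N G" and "relative_polycyclic (G\<lparr>carrier := N\<rparr>) A T"
  shows "relative_polycyclic G A T"
  using assms(2)
proof (induction rule: relative_polycyclic.induct)
  case base
  then show ?case using incl_subgroup[OF N] by (blast intro: relative_polycyclic.base)
next
  case (step K T)
  have sub: "subgroup T (G\<lparr>carrier := N\<rparr>)" using step by (simp add: cyclic_extension_def)
  then have "T \<subseteq> N" using subgroup.subset by fastforce
  then have "cyclic_extension G K T"
    using step(2) incl_subgroup[OF N] m_inv_consistent[OF N] int_pow_consistent[OF N]
    unfolding cyclic_extension_def by (simp add: subset_iff)
  then show ?case using step by (blast intro: relative_polycyclic.step)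
qed

text \<open>
  With the identity, an embedding or a projection as the homomorphism, and with
  \<open>relative_polycyclic_trans\<close>, this covers subgroups, embedded groups and extensions at once.
\<close>

lemma (in group_hom) relative_polycyclic_pullback:
  assumes "relative_polycyclic H B S" "subgroup T G" "h ` T \<subseteq> S"
  shows "relative_polycyclic G {g \<in> T. h g \<in> B} T"
  using assms
proof (induction arbitrary: T rule: relative_polycyclic.induct)
  case (base T)
  then have "{g \<in> T. h g \<in> B} = T" by auto
  then show ?case using base by (simp add: relative_polycyclic.base)
next
  case (step K S T)
  have ext: "cyclic_extension G {g \<in> T. h g \<in> K} T"
    by (rule cyclic_extension_pullback[OF step.hyps(2) step.prems])
  have "B \<subseteq> K" using relative_polycyclic_subgroups[OF step.hyps(1)] by blast
  then have "{g \<in> {g \<in> T. h g \<in> K}. h g \<in> B} = {g \<in> T. h g \<in> B}" by auto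
  moreover have "relative_polycyclic G {g \<in> {g \<in> T. h g \<in> K}. h g \<in> B} {g \<in> T. h g \<in> K}"
    using ext by (intro step.IH) (auto simp: cyclic_extension_def)
  ultimately show ?case using relative_polycyclic.step[OF _ ext] by simp
qed

lemma (in group) polycyclic_by_finite_iff:
  "polycyclic_by_finite G \<longleftrightarrow>
    (\<exists>N. N \<lhd> G \<and> relative_polycyclic G {\<one>} N \<and> finite (rcosets N))"
proof -
  have "polycyclic (G\<lparr>carrier := N\<rparr>) \<longleftrightarrow> relative_polycyclic G {\<one>} N" if n: "N \<lhd> G" for N
  proof -
    let ?N = "G\<lparr>carrier := N\<rparr>"
    have N: "subgroup N G" using n by (rule normal_imp_subgroup)
    interpret N: group ?N using subgroup.subgroup_is_group[OF N group_axioms] .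
    have "group_hom ?N G id"
      using N by unfold_locales (auto simp: hom_def subgroup.mem_carrier)
    moreover have "subgroup N ?N" using N.subgroup_self by simp
    ultimately have "relative_polycyclic G {\<one>} N \<Longrightarrow> relative_polycyclic ?N {g \<in> N. id g \<in> {\<one>}} N"
      using group_hom.relative_polycyclic_pullback[of ?N G id "{\<one>}" N N] by simp
    moreover have "{g \<in> N. id g \<in> {\<one>}} = {\<one>}" using subgroup.one_closed[OF N] by auto
    ultimately have "relative_polycyclic G {\<one>} N \<longleftrightarrow> relative_polycyclic ?N {\<one>} N"
      using relative_polycyclic_in_subgroup[OF N] by auto
    then show ?thesis
      using N.polycyclic_seq_iff_relative[of N] N.group_axioms by (simp add: polycyclic_def)
  qed
  then show ?thesis unfolding polycyclic_by_finite_def by blast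
qed

section \<open>Finite generation\<close>

lemma (in group) cyclic_extension_subgroup:
  assumes "cyclic_extension G K T" "subgroup U G" "U \<subseteq> T"
  shows "cyclic_extension G (U \<inter> K) U"
proof -
  interpret group_hom G G id by unfold_locales (simp add: hom_def)
  show ?thesis using cyclic_extension_pullback[OF assms(1,2)] assms(3) by (simp add: Int_def)
qed

lemma (in group) cyclic_extension_left_coset:
  assumes ext: "cyclic_extension G K T" and g: "g \<in> T" "g \<in> K #> t" and t: "t \<in> T"
  obtains k where "k \<in> K" "g = t \<otimes> k"
proof -
  obtain k where k: "k \<in> K" "g = k \<otimes> t" using g(2) unfolding r_coset_def by blast
  note D = cyclic_extensionD[OF ext]
  have c: "k \<in> carrier G" "t \<in> carrier G"
    using k(1) t by (simp_all add: subgroup.mem_carrier[OF D(1)] subgroup.mem_carrier[OF D(2)])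
  have "inv t \<otimes> k \<otimes> inv (inv t) \<in> K"
    using D(4) subgroup.m_inv_closed[OF D(2) t] k(1) by blast
  then show ?thesis
    using that[of "inv t \<otimes> k \<otimes> t"] c k by (simp add: m_assoc)
qed

text \<open>
  The maximal condition for polycyclic groups, in relative form: one generator is needed for
  each cyclic factor of the series.
\<close>

lemma (in group) finitely_generated_modulo:
  assumes "relative_polycyclic G A T" "subgroup U G" "U \<subseteq> T"
  shows "\<exists>F. finite F \<and> F \<subseteq> U \<and> (\<forall>u\<in>U. \<exists>v\<in>generate G F. \<exists>a\<in>U \<inter> A. u = v \<otimes> a)"
  using assms
proof (induction arbitrary: U rule: relative_polycyclic.induct)
  case base
  then have "\<exists>v\<in>generate G {}. \<exists>a\<in>U \<inter> A. u = v \<otimes> a" if "u \<in> U" for u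
    using that subgroup.mem_carrier[OF base(2)]
    by (intro bexI[of _ \<one>] bexI[of _ u]) (auto intro: generate.one)
  then show ?case by (intro exI[of _ "{}"]) auto
next
  case (step K T)
  note sub = cyclic_extension_subgroup[OF step.hyps(2) step.prems]
  note D = cyclic_extensionD[OF sub]
  obtain t where t: "t \<in> U" "\<And>g. g \<in> U \<Longrightarrow> \<exists>n::int. g \<in> (U \<inter> K) #> t [^] n"
    using cyclic_extension_generator[OF sub] by metis
  obtain F where F: "finite F" "F \<subseteq> U \<inter> K"
    "\<And>u. u \<in> U \<inter> K \<Longrightarrow> \<exists>v\<in>generate G F. \<exists>a\<in>U \<inter> K \<inter> A. u = v \<otimes> a"
    using step.IH[OF D(1)] by auto
  have Uc: "U \<subseteq> carrier G" using step.prems(1) by (rule subgroup.subset)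
  have sg: "subgroup (generate G (insert t F)) G"
    using t(1) F(2) Uc by (intro generate_is_subgroup) auto
  have mono: "generate G F \<subseteq> generate G (insert t F)" by (rule mono_generate) auto
  have "\<exists>v\<in>generate G (insert t F). \<exists>a\<in>U \<inter> A. u = v \<otimes> a" if u: "u \<in> U" for u
  proof -
    obtain n :: int where n: "u \<in> (U \<inter> K) #> t [^] n" using t(2)[OF u] by blast
    have tn: "t [^] n \<in> U" by (rule subgroup_int_pow_closed[OF step.prems(1) t(1)])
    obtain k where k: "k \<in> U \<inter> K" "u = t [^] n \<otimes> k"
      using cyclic_extension_left_coset[OF sub u n tn] by metis
    obtain v a where va: "v \<in> generate G F" "a \<in> U \<inter> K \<inter> A" "k = v \<otimes> a"
      using F(3)[OF k(1)] by blast
    have c: "v \<in> carrier G" "a \<in> carrier G" "t [^] n \<in> carrier G"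
      using va(2) tn Uc generate_in_carrier[OF _ va(1)] F(2) by auto
    have "t [^] n \<otimes> v \<in> generate G (insert t F)"
      using mono va(1) subgroup_int_pow_closed[OF sg]
      by (intro subgroup.m_closed[OF sg]) (auto intro: generate.incl)
    moreover have "u = t [^] n \<otimes> v \<otimes> a" using k va c by (simp add: m_assoc)
    ultimately show ?thesis using va(2) by blast
  qed
  then show ?case using F(1,2) t(1) by (intro exI[of _ "insert t F"]) auto
qed

text \<open>
  Schreier's argument. Choose a representative \<open>\<rho> g\<close> of each coset of \<open>T\<close>, with \<open>\<rho> \<one> = \<one>\<close>. The elements
  \<open>\<sigma> g h = \<rho> g h (\<rho> (g h))\<inverse>\<close> lie in \<open>T\<close>, satisfy the cocycle identity
  \<open>\<sigma> g (h h') = \<sigma> g h \<sigma> (g h) h'\<close>, and \<open>\<sigma> \<one> h = h\<close> for \<open>h\<close> in \<open>T\<close>. So \<open>T\<close> is generated by the \<open>\<sigma> g x\<close>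
  with \<open>x\<close> in \<open>X\<close>, and these are finitely many because \<open>\<sigma> g x\<close> depends only on the coset of \<open>g\<close>.
\<close>

lemma (in group) finite_index_finitely_generated:
  assumes X: "finite X" "X \<subseteq> carrier G" "generate G X = carrier G"
    and T: "subgroup T G" and fin: "finite (rcosets T)"
  shows "\<exists>Y. finite Y \<and> Y \<subseteq> T \<and> T = generate G Y"
proof -
  have Tc: "T \<subseteq> carrier G" using T by (rule subgroup.subset)
  define r where "r C = (if C = T then \<one> else SOME g. g \<in> C)" for C
  define \<rho> where "\<rho> g = r (T #> g)" for g
  have \<rho>: "\<rho> g \<in> T #> g" if "g \<in> carrier G" for g
  proof (cases "T #> g = T")
    case True then show ?thesis using subgroup.one_closed[OF T] by (simp add: \<rho>_def r_def)
  next
    case False then show ?thesis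
      using rcos_self[OF that T] unfolding \<rho>_def r_def by (auto intro: someI)
  qed
  have \<rho>c: "\<rho> g \<in> carrier G" if "g \<in> carrier G" for g
    using \<rho>[OF that] r_coset_subset_G[OF Tc that] by blast
  have coset: "T #> \<rho> g = T #> g" if "g \<in> carrier G" for g
    using repr_independence[OF \<rho>[OF that] that T] by simp
  have \<rho>1: "\<rho> g = \<one>" if "g \<in> T" for g
    using that coset_join2[of g T] T Tc by (auto simp: \<rho>_def r_def)
  have coset_mult: "\<rho> (\<rho> g \<otimes> h) = \<rho> (g \<otimes> h)" if "g \<in> carrier G" "h \<in> carrier G" for g h
    using coset_mult_assoc[OF Tc, of g h] coset_mult_assoc[OF Tc, of "\<rho> g" h] coset that \<rho>c
    by (simp add: \<rho>_def)
  define \<sigma> where "\<sigma> g h = \<rho> g \<otimes> h \<otimes> inv (\<rho> (g \<otimes> h))" for g h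
  have \<sigma>T: "\<sigma> g h \<in> T" if "g \<in> carrier G" "h \<in> carrier G" for g h
  proof -
    have "\<rho> g \<otimes> h \<in> T #> \<rho> (g \<otimes> h)"
      using rcos_self[of "\<rho> g \<otimes> h" T] coset[of "\<rho> g \<otimes> h"] coset_mult[OF that] that \<rho>c T by simp
    then show ?thesis
      unfolding \<sigma>_def using subgroup.rcos_module_imp[OF T group_axioms] that \<rho>c by simp
  qed
  define Y where "Y = (\<lambda>(s, x). s \<otimes> x \<otimes> inv (\<rho> (s \<otimes> x))) ` (\<rho> ` carrier G \<times> X)"
  have "\<rho> ` carrier G \<subseteq> r ` (rcosets T)"
    using Tc by (auto simp: \<rho>_def intro: rcosetsI)
  then have "finite Y"
    unfolding Y_def using fin X(1) finite_subset by blast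
  have \<sigma>Y: "\<sigma> g x \<in> Y" if "g \<in> carrier G" "x \<in> X" for g x
    unfolding Y_def \<sigma>_def using that X(2) coset_mult[of g x]
    by (auto intro!: image_eqI[of _ _ "(\<rho> g, x)"])
  have YT: "Y \<subseteq> T"
  proof
    fix y assume "y \<in> Y"
    then obtain g x where gx: "g \<in> carrier G" "x \<in> X" "y = \<rho> g \<otimes> x \<otimes> inv (\<rho> (\<rho> g \<otimes> x))"
      by (auto simp: Y_def)
    then show "y \<in> T" using \<sigma>T[of g x] X(2) coset_mult[of g x] by (auto simp: \<sigma>_def)
  qed
  have Y: "subgroup (generate G Y) G" using YT Tc by (intro generate_is_subgroup) auto
  have hc: "h \<in> carrier G" if "h \<in> generate G X" for h using that X(3) by simp
  have \<sigma>_gen: "\<forall>g\<in>carrier G. \<sigma> g h \<in> generate G Y" if "h \<in> generate G X" for h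
    using that
  proof (induction rule: generate.induct)
    case one
    then show ?case using \<rho>c subgroup.one_closed[OF Y] by (simp add: \<sigma>_def)
  next
    case (incl x)
    then show ?case using \<sigma>Y by (auto intro: generate.incl)
  next
    case (inv x)
    show ?case
    proof
      fix g assume g: "g \<in> carrier G"
      have x: "x \<in> carrier G" using inv X(2) by blast
      have "\<sigma> g (inv x) = inv (\<sigma> (g \<otimes> inv x) x)"
        using g x \<rho>c by (simp add: \<sigma>_def inv_mult_group m_assoc)
      then show "\<sigma> g (inv x) \<in> generate G Y"
        using \<sigma>Y[of "g \<otimes> inv x" x] g x inv by (auto intro: generate.inv)
    qed
  next
    case (eng h h')
    show ?case
    proof
      fix g assume g: "g \<in> carrier G"
      have "\<sigma> g (h \<otimes> h') = \<sigma> g h \<otimes> \<sigma> (g \<otimes> h) h'"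
        using g hc[OF eng(1)] hc[OF eng(2)] \<rho>c by (simp add: \<sigma>_def inv_mult_group m_assoc)
      then show "\<sigma> g (h \<otimes> h') \<in> generate G Y"
        using eng g hc by (simp add: generate.eng)
    qed
  qed
  have "T \<subseteq> generate G Y"
  proof
    fix h assume h: "h \<in> T"
    have "\<sigma> \<one> h = h"
      using h Tc \<rho>1[of \<one>] \<rho>1[OF h] subgroup.one_closed[OF T] by (auto simp: \<sigma>_def)
    moreover have "\<sigma> \<one> h \<in> generate G Y"
      using \<sigma>_gen[of h] h Tc X(3) one_closed by blast
    ultimately show "h \<in> generate G Y" by simp
  qed
  moreover have "generate G Y \<subseteq> T" by (rule generate_subgroup_incl[OF YT T])
  ultimately show ?thesis using \<open>finite Y\<close> YT by blast
qed

text \<open>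
  Generators of \<open>U \<inter> N\<close> together with one element of \<open>U\<close> for each coset of \<open>N\<close> that \<open>U\<close> meets.
\<close>

lemma (in group) subgroup_finitely_generated:
  assumes "polycyclic_by_finite G" and U: "subgroup U G"
  shows "\<exists>F. finite F \<and> F \<subseteq> U \<and> U = generate G F"
proof -
  obtain N where N: "N \<lhd> G" "relative_polycyclic G {\<one>} N" "finite (rcosets N)"
    using assms(1) polycyclic_by_finite_iff by blast
  have Ns: "subgroup N G" by (rule normal_imp_subgroup[OF N(1)])
  have UN: "subgroup (U \<inter> N) G" using U Ns by (rule subgroups_Inter_pair)
  have Uc: "U \<subseteq> carrier G" using U by (rule subgroup.subset)
  obtain F where F: "finite F" "F \<subseteq> U \<inter> N"
    "\<And>u. u \<in> U \<inter> N \<Longrightarrow> \<exists>v\<in>generate G F. \<exists>a\<in>U \<inter> N \<inter> {\<one>}. u = v \<otimes> a"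
    using finitely_generated_modulo[OF N(2) UN] by auto
  have Fc: "F \<subseteq> carrier G" using F(2) Uc by blast
  have UNF: "U \<inter> N \<subseteq> generate G F"
    using F(3) generate_in_carrier[OF Fc] by fastforce
  define C where "C = (\<lambda>u. N #> u) ` U"
  have "C \<subseteq> rcosets N" unfolding C_def using Uc by (auto intro!: rcosetsI[OF subgroup.subset[OF Ns]])
  then have C: "finite C" using N(3) finite_subset by blast
  define s where "s c = (SOME u. u \<in> U \<and> N #> u = c)" for c
  have s: "s c \<in> U \<and> N #> s c = c" if "c \<in> C" for c
    unfolding s_def by (rule someI_ex) (use that C_def in blast)
  let ?F = "F \<union> s ` C"
  have sub: "?F \<subseteq> U" using F(2) s by auto
  have gen: "subgroup (generate G ?F) G" using sub Uc by (intro generate_is_subgroup) auto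
  have "u \<in> generate G ?F" if u: "u \<in> U" for u
  proof -
    define c where "c = N #> u"
    have c: "c \<in> C" using u by (auto simp: C_def c_def)
    have sc: "s c \<in> U" "N #> s c = N #> u" using s[OF c] by (auto simp: c_def)
    then have "u \<in> N #> s c" using rcos_self[of u N] u Uc Ns by auto
    then have "u \<otimes> inv (s c) \<in> U \<inter> N"
      using subgroup.rcos_module_imp[OF Ns group_axioms, of "s c" u] sc(1) u Uc
      by (auto intro: subgroup.m_closed[OF U] subgroup.m_inv_closed[OF U])
    then have "u \<otimes> inv (s c) \<in> generate G ?F"
      using UNF mono_generate[of F ?F] by blast
    moreover have "s c \<in> generate G ?F" using c by (auto intro: generate.incl)
    ultimately have "u \<otimes> inv (s c) \<otimes> s c \<in> generate G ?F" by (rule generate.eng)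
    moreover have "u \<in> carrier G" "s c \<in> carrier G" using u sc(1) Uc by auto
    ultimately show ?thesis by (simp add: m_assoc)
  qed
  then have "U = generate G ?F"
    using generate_subgroup_incl[OF sub U] by blast
  then show ?thesis using F(1) C sub by (intro exI[of _ ?F]) simp
qed

section \<open>Central extensions\<close>

lemma (in group) conjugation_trivial_if_commute:
  assumes "t \<otimes> m = m \<otimes> t" "t \<in> carrier G" "m \<in> carrier G"
  shows "t \<otimes> m \<otimes> inv t = m" "inv t \<otimes> m \<otimes> t = m"
proof -
  show "t \<otimes> m \<otimes> inv t = m" unfolding assms(1) using assms(2,3) by (simp add: m_assoc)
  show "inv t \<otimes> m \<otimes> t = m" using assms by (simp add: m_assoc flip: assms(1))
qed

lemma (in group) commuting_polycyclic:
  assumes "finite X" "X \<subseteq> carrier G" "\<And>x y. x \<in> X \<Longrightarrow> y \<in> X \<Longrightarrow> x \<otimes> y = y \<otimes> x"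
  shows "relative_polycyclic G {\<one>} (generate G X)"
  using assms
proof (induction rule: finite_induct)
  case empty
  then show ?case by (simp add: generate_empty relative_polycyclic.base triv_subgroup)
next
  case (insert t X)
  have c: "X \<subseteq> carrier G" "t \<in> carrier G" using insert.prems by auto
  have M: "subgroup (generate G X) G" by (rule generate_is_subgroup[OF c(1)])
  have comm: "t \<otimes> m = m \<otimes> t" if "m \<in> generate G X" for m
    using that
  proof (induction rule: generate.induct)
    case (inv h)
    then have h: "h \<in> carrier G" "t \<otimes> h = h \<otimes> t" using insert.prems c by auto
    have "inv h \<otimes> (t \<otimes> h) \<otimes> inv h = inv h \<otimes> (h \<otimes> t) \<otimes> inv h" by (simp only: h(2))
    then show ?case using h(1) c(2) by (simp add: m_assoc)
  next
    case (eng g h)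
    then have "g \<in> carrier G" "h \<in> carrier G" using generate_in_carrier[OF c(1)] by auto
    then show ?case using eng c by (metis m_assoc)
  qed (use c insert.prems in auto)
  have mc: "m \<in> carrier G" if "m \<in> generate G X" for m using that generate_in_carrier[OF c(1)] by blast
  have "t \<otimes> m \<otimes> inv t = m" "inv t \<otimes> m \<otimes> t = m" if "m \<in> generate G X" for m
    using conjugation_trivial_if_commute[OF comm[OF that] c(2) mc[OF that]] by simp_all
  then have "cyclic_extension G (generate G X) (generate G (insert t X))"
    using cyclic_extension_insert[OF M c(2)] generate_insert_generate[OF c] by simp
  moreover have "relative_polycyclic G {\<one>} (generate G X)"
    using insert by auto
  ultimately show ?case by (rule relative_polycyclic.step [rotated])
qed

lemma (in group) generate_conjugation_closed:
  assumes t: "t \<in> carrier G" and Y: "Y \<subseteq> carrier G"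
    and conj: "\<And>y. y \<in> Y \<Longrightarrow> t \<otimes> y \<otimes> inv t \<in> generate G Y"
    and g: "g \<in> generate G Y"
  shows "t \<otimes> g \<otimes> inv t \<in> generate G Y"
  using g
proof (induction rule: generate.induct)
  case one
  then show ?case using t by (simp add: generate.one)
next
  case (incl h)
  then show ?case by (rule conj)
next
  case (inv h)
  then have "t \<otimes> inv h \<otimes> inv t = inv (t \<otimes> h \<otimes> inv t)"
    using t Y by (auto simp: inv_mult_group m_assoc)
  then show ?case using conj[OF inv] generate_m_inv_closed[OF Y] by simp
next
  case (eng g h)
  then have "t \<otimes> (g \<otimes> h) \<otimes> inv t = (t \<otimes> g \<otimes> inv t) \<otimes> (t \<otimes> h \<otimes> inv t)"
    using t generate_in_carrier[OF Y] by (simp add: m_assoc)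
  then show ?case using eng by (simp add: generate.eng)
qed

text \<open>
  This is where finite generation of the whole group forces the central kernel to be small. The usual
  proof uses that polycyclic groups are finitely presented; here the finitely many central
  elements that are needed are collected along the series instead.

  In the induction step, \<open>E = \<langle>X\<rangle>\<close> is generated by \<open>M = E \<inter> K\<close> and an element \<open>t\<close>. The group \<open>M\<close> itself is
  not known to be finitely generated, but it is so modulo \<open>Z\<close>, say by \<open>F\<close>. Every element of \<open>M\<close> is a
  product of an element of \<open>\<langle>F\<rangle>\<close> and a central correction in \<open>Z\<close>. Adjoining to \<open>F\<close> the corrections of
  finitely many elements yields a finitely generated subgroup \<open>N\<close> of \<open>M\<close> that is
  normalised by \<open>t\<close> and contains the parts of the generators \<open>X\<close> in \<open>M\<close>. Then \<open>N\<close> is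
  polycyclic by the induction hypothesis, and \<open>E\<close> is the cyclic extension of \<open>N\<close> by \<open>t\<close>.
\<close>

lemma (in group) finitely_generated_central_extension:
  assumes "relative_polycyclic G Z T" "\<And>z g. z \<in> Z \<Longrightarrow> g \<in> T \<Longrightarrow> z \<otimes> g = g \<otimes> z"
    and "finite X" "X \<subseteq> T"
  shows "relative_polycyclic G {\<one>} (generate G X)"
  using assms
proof (induction arbitrary: X rule: relative_polycyclic.induct)
  case base
  then show ?case
    by (intro commuting_polycyclic) (auto dest: subgroup.mem_carrier)
next
  case (step K T)
  note D = cyclic_extensionD[OF step.hyps(2)]
  have Tc: "T \<subseteq> carrier G" using D(2) by (rule subgroup.subset)
  let ?E = "generate G X"
  have Xc: "X \<subseteq> carrier G" using step.prems(3) Tc by blast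
  have E: "subgroup ?E G" by (rule generate_is_subgroup[OF Xc])
  have ET: "?E \<subseteq> T" by (rule generate_subgroup_incl[OF step.prems(3) D(2)])
  note extE = cyclic_extension_subgroup[OF step.hyps(2) E ET]
  let ?M = "?E \<inter> K"
  note DE = cyclic_extensionD[OF extE]
  obtain t where t: "t \<in> ?E" "\<And>g. g \<in> ?E \<Longrightarrow> \<exists>n::int. g \<in> ?M #> t [^] n"
    using cyclic_extension_generator[OF extE] by metis
  obtain F where F: "finite F" "F \<subseteq> ?M"
    "\<And>u. u \<in> ?M \<Longrightarrow> \<exists>v\<in>generate G F. \<exists>a\<in>?M \<inter> Z. u = v \<otimes> a"
    using finitely_generated_modulo[OF step.hyps(1) DE(1)] by auto
  obtain c where c: "\<And>m. m \<in> ?M \<Longrightarrow> c m \<in> ?M \<inter> Z \<and> (\<exists>v\<in>generate G F. m = v \<otimes> c m)"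
    using F(3) by metis
  have "\<exists>k n. k \<in> ?M \<and> x = k \<otimes> t [^] (n::int)" if "x \<in> X" for x
    using t(2)[OF generate.incl[OF that]] unfolding r_coset_def by blast
  then obtain k n where kn: "\<And>x. x \<in> X \<Longrightarrow> k x \<in> ?M \<and> x = k x \<otimes> t [^] (n x :: int)"
    by metis
  \<comment> \<open>The elements of M that must lie in N: conjugates of F make N invariant under t, and the k x
    ensure that N and t generate X.\<close>
  define W where "W = (\<lambda>f. t \<otimes> f \<otimes> inv t) ` F \<union> (\<lambda>f. inv t \<otimes> f \<otimes> t) ` F \<union> k ` X"
  have Ec: "?E \<subseteq> carrier G" using E by (rule subgroup.subset)
  have tc: "t \<in> carrier G" using t(1) Ec by blast
  have conjM: "t \<otimes> m \<otimes> inv t \<in> ?M" "inv t \<otimes> m \<otimes> t \<in> ?M" if "m \<in> ?M" for m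
    using DE(4)[OF t(1) that] DE(4)[OF subgroup.m_inv_closed[OF E t(1)] that] tc by auto
  have WM: "W \<subseteq> ?M" unfolding W_def using conjM F(2) kn by blast
  have Wfin: "finite W" unfolding W_def using F(1) step.prems(2) by simp
  let ?Y = "F \<union> c ` W"
  let ?N = "generate G ?Y"
  have YM: "?Y \<subseteq> ?M" using F(2) c WM by blast
  have Yc: "?Y \<subseteq> carrier G" using YM Ec by blast
  have N: "subgroup ?N G" by (rule generate_is_subgroup[OF Yc])
  have WN: "w \<in> ?N" if "w \<in> W" for w
  proof -
    have "w \<in> ?M" using WM that by (rule subsetD)
    then obtain v where v: "v \<in> generate G F" "w = v \<otimes> c w" using c[of w] by metis
    have "c w \<in> ?N" using that by (auto intro: generate.incl)
    moreover have "v \<in> ?N" using v(1) mono_generate[of F ?Y] by blast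
    ultimately show ?thesis using v(2) generate.eng by metis
  qed
  have central: "t \<otimes> y \<otimes> inv t = y" "inv t \<otimes> y \<otimes> t = y" if "y \<in> c ` W" for y
  proof -
    have y: "y \<in> Z" "y \<in> carrier G" using that c WM Yc by blast+
    have "t \<otimes> y = y \<otimes> t" using step.prems(1)[OF y(1), of t] t(1) ET by auto
    then show "t \<otimes> y \<otimes> inv t = y" "inv t \<otimes> y \<otimes> t = y"
      using conjugation_trivial_if_commute tc y(2) by blast+
  qed
  have conj1: "t \<otimes> g \<otimes> inv t \<in> ?N" if "g \<in> ?N" for g
  proof (rule generate_conjugation_closed[OF tc Yc _ that])
    fix y assume y: "y \<in> ?Y"
    then show "t \<otimes> y \<otimes> inv t \<in> ?N"
    proof
      assume "y \<in> F" then show ?thesis by (intro WN) (auto simp: W_def)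
    next
      assume "y \<in> c ` W" then show ?thesis using central y by (auto intro: generate.incl)
    qed
  qed
  have conj2: "inv t \<otimes> g \<otimes> t \<in> ?N" if "g \<in> ?N" for g
  proof -
    have "inv t \<otimes> g \<otimes> inv (inv t) \<in> ?N"
    proof (rule generate_conjugation_closed[OF _ Yc _ that])
      fix y assume y: "y \<in> ?Y"
      then have "inv t \<otimes> y \<otimes> t \<in> ?N"
      proof
        assume "y \<in> F" then show ?thesis by (intro WN) (auto simp: W_def)
      next
        assume "y \<in> c ` W" then show ?thesis using central y by (auto intro: generate.incl)
      qed
      then show "inv t \<otimes> y \<otimes> inv (inv t) \<in> ?N" using tc by simp
    qed (use tc in simp)
    then show ?thesis using tc by simp
  qed
  have ext: "cyclic_extension G ?N (generate G (insert t ?N))"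
    by (rule cyclic_extension_insert[OF N tc conj1 conj2])
  have NE: "?N \<subseteq> ?E" using generate_subgroup_incl[OF _ E] YM by blast
  have big: "subgroup (generate G (insert t ?N)) G"
    using tc NE Ec by (intro generate_is_subgroup) auto
  have "generate G (insert t ?N) = ?E"
  proof
    show "generate G (insert t ?N) \<subseteq> ?E"
      using NE t(1) by (intro generate_subgroup_incl[OF _ E]) auto
    have "x \<in> generate G (insert t ?N)" if x: "x \<in> X" for x
    proof -
      have "k x \<in> ?N" using x by (intro WN) (auto simp: W_def)
      then have "k x \<in> generate G (insert t ?N)" by (auto intro: generate.incl)
      moreover have "t [^] n x \<in> generate G (insert t ?N)"
        by (intro subgroup_int_pow_closed[OF big]) (auto intro: generate.incl)
      ultimately have "k x \<otimes> t [^] n x \<in> generate G (insert t ?N)" by (rule generate.eng)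
      then show ?thesis using kn[OF x] by simp
    qed
    then show "?E \<subseteq> generate G (insert t ?N)"
      by (intro generate_subgroup_incl[OF _ big]) blast
  qed
  moreover have "relative_polycyclic G {\<one>} ?N"
  proof (rule step.IH)
    show "z \<otimes> g = g \<otimes> z" if "z \<in> Z" "g \<in> K" for z g using step.prems(1) that D(3) by blast
    show "finite ?Y" using F(1) Wfin by simp
    show "?Y \<subseteq> K" using YM by blast
  qed
  ultimately show ?case using relative_polycyclic.step ext by metis
qed

lemma (in group) finite_rcosets_if_separated:
  assumes T: "subgroup T G" and fin: "finite (c ` carrier G)"
    and sep: "\<And>g h. g \<in> carrier G \<Longrightarrow> h \<in> carrier G \<Longrightarrow> c g = c h \<Longrightarrow> g \<otimes> inv h \<in> T"
  shows "finite (rcosets T)"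
proof -
  define s where "s x = (SOME g. g \<in> carrier G \<and> c g = x)" for x
  have s: "s (c g) \<in> carrier G \<and> c (s (c g)) = c g" if "g \<in> carrier G" for g
    unfolding s_def by (rule someI_ex) (use that in blast)
  have "T #> g = T #> s (c g)" if g: "g \<in> carrier G" for g
  proof -
    have "g \<otimes> inv (s (c g)) \<in> T" using sep[OF g, of "s (c g)"] s[OF g] by simp
    then have "g \<in> T #> s (c g)"
      using subgroup.rcos_module_rev[OF T group_axioms] s[OF g] g by blast
    then show ?thesis using repr_independence[OF _ _ T] s[OF g] by metis
  qed
  then have "rcosets T \<subseteq> (\<lambda>x. T #> s x) ` (c ` carrier G)"
    unfolding RCOSETS_def by blast
  then show ?thesis using fin finite_subset by blast
qed

text \<open>
  Several homomorphisms into the same group \<open>P\<close> are allowed, which saves the treatment of direct powers of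
  \<open>P\<close>. The preimage \<open>T\<close> of a polycyclic normal subgroup of finite index has finite index, hence is finitely
  generated, and it is polycyclic modulo the common kernel \<open>Z\<close>; since \<open>Z\<close> is central,
  \<open>finitely_generated_central_extension\<close> applies.
\<close>

theorem (in group) polycyclic_by_finite_if_central_kernel:
  assumes X: "finite X" "X \<subseteq> carrier G" "generate G X = carrier G"
    and P: "group P" "polycyclic_by_finite P"
    and \<F>: "finite \<F>" "\<And>f. f \<in> \<F> \<Longrightarrow> f \<in> hom G P"
    and central: "\<And>z g. z \<in> carrier G \<Longrightarrow> (\<And>f. f \<in> \<F> \<Longrightarrow> f z = \<one>\<^bsub>P\<^esub>) \<Longrightarrow> g \<in> carrier G \<Longrightarrow>
      z \<otimes> g = g \<otimes> z"
  shows "polycyclic_by_finite G"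
proof -
  obtain N where N: "N \<lhd> P" "relative_polycyclic P {\<one>\<^bsub>P\<^esub>} N" "finite (rcosets\<^bsub>P\<^esub> N)"
    using P(2) group.polycyclic_by_finite_iff[OF P(1)] by blast
  have Ns: "subgroup N P" by (rule normal_imp_subgroup[OF N(1)])
  interpret P: group P by (rule P(1))
  have hom: "group_hom G P f" if "f \<in> \<F>" for f
    using \<F>(2)[OF that] by unfold_locales
  define T where "T = {g \<in> carrier G. \<forall>f\<in>\<F>. f g \<in> N}"
  define Z where "Z = {g \<in> T. \<forall>f\<in>\<F>. f g = \<one>\<^bsub>P\<^esub>}"
  have T: "T \<lhd> G"
  proof (rule normal_invI)
    show "subgroup T G"
    proof (rule subgroupI)
      have "\<one> \<in> T" using group_hom.hom_one[OF hom] subgroup.one_closed[OF Ns] by (auto simp: T_def)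
      then show "T \<noteq> {}" by blast
    qed (auto simp: T_def group_hom.hom_mult[OF hom] group_hom.hom_inv[OF hom]
        subgroup.m_closed[OF Ns] subgroup.m_inv_closed[OF Ns])
    fix g h assume "g \<in> carrier G" "h \<in> T"
    then show "g \<otimes> h \<otimes> inv g \<in> T"
      by (auto simp: T_def group_hom.hom_mult[OF hom] group_hom.hom_inv[OF hom]
          normal.inv_op_closed2[OF N(1)] group_hom.hom_closed[OF hom])
  qed
  then have Ts: "subgroup T G" by (rule normal_imp_subgroup)
  have "finite \<G> \<Longrightarrow> \<G> \<subseteq> \<F> \<Longrightarrow> relative_polycyclic G {g \<in> T. \<forall>f\<in>\<G>. f g = \<one>\<^bsub>P\<^esub>} T" for \<G>
  proof (induction rule: finite_induct)
    case empty
    then show ?case using relative_polycyclic.base[OF Ts] by simp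
  next
    case (insert f \<G>)
    let ?A = "{g \<in> T. \<forall>f\<in>\<G>. f g = \<one>\<^bsub>P\<^esub>}"
    have IH: "relative_polycyclic G ?A T" using insert by auto
    have A: "subgroup ?A G" using relative_polycyclic_subgroups[OF IH] by blast
    have "relative_polycyclic G {g \<in> ?A. f g \<in> {\<one>\<^bsub>P\<^esub>}} ?A"
      using insert.prems by (intro group_hom.relative_polycyclic_pullback[OF hom N(2) A]) (auto simp: T_def)
    moreover have "{g \<in> ?A. f g \<in> {\<one>\<^bsub>P\<^esub>}} = {g \<in> T. \<forall>f\<in>insert f \<G>. f g = \<one>\<^bsub>P\<^esub>}" by auto
    ultimately show ?case using relative_polycyclic_trans[OF IH] by simp
  qed
  then have ZT: "relative_polycyclic G Z T" using \<F>(1) by (auto simp: Z_def)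
  have "finite (rcosets T)"
  proof (rule finite_rcosets_if_separated[OF Ts, of "\<lambda>g. \<lambda>f\<in>\<F>. N #>\<^bsub>P\<^esub> f g"])
    have "(\<lambda>g. \<lambda>f\<in>\<F>. N #>\<^bsub>P\<^esub> f g) ` carrier G \<subseteq> (\<Pi>\<^sub>E f\<in>\<F>. rcosets\<^bsub>P\<^esub> N)"
      using group_hom.hom_closed[OF hom] subgroup.subset[OF Ns] by (auto intro!: P.rcosetsI)
    then show "finite ((\<lambda>g. \<lambda>f\<in>\<F>. N #>\<^bsub>P\<^esub> f g) ` carrier G)"
      using finite_PiE[OF \<F>(1), of "\<lambda>_. rcosets\<^bsub>P\<^esub> N"] N(3) finite_subset by blast
    fix g h assume gh: "g \<in> carrier G" "h \<in> carrier G"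
      "(\<lambda>f\<in>\<F>. N #>\<^bsub>P\<^esub> f g) = (\<lambda>f\<in>\<F>. N #>\<^bsub>P\<^esub> f h)"
    have "f (g \<otimes> inv h) \<in> N" if f: "f \<in> \<F>" for f
    proof -
      have c: "f g \<in> carrier P" "f h \<in> carrier P" using group_hom.hom_closed[OF hom[OF f]] gh by auto
      have "N #>\<^bsub>P\<^esub> f g = N #>\<^bsub>P\<^esub> f h" using fun_cong[OF gh(3), of f] f by simp
      then have "f g \<in> N #>\<^bsub>P\<^esub> f h" using P.rcos_self[OF c(1) Ns] by simp
      then have "f g \<otimes>\<^bsub>P\<^esub> inv\<^bsub>P\<^esub> f h \<in> N"
        using subgroup.rcos_module_imp[OF Ns P.group_axioms c(2)] by simp
      then show ?thesis using gh by (simp add: group_hom.hom_mult[OF hom[OF f]] group_hom.hom_inv[OF hom[OF f]])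
    qed
    then show "g \<otimes> inv h \<in> T" using gh by (simp add: T_def)
  qed
  moreover obtain Y where Y: "finite Y" "Y \<subseteq> T" "T = generate G Y"
    using finite_index_finitely_generated[OF X Ts calculation] by blast
  have "relative_polycyclic G {\<one>} (generate G Y)"
  proof (rule finitely_generated_central_extension[OF ZT _ Y(1,2)])
    show "z \<otimes> g = g \<otimes> z" if "z \<in> Z" "g \<in> T" for z g
      using that by (intro central subgroup.mem_carrier[OF Ts]) (simp_all add: Z_def)
  qed
  ultimately show ?thesis unfolding polycyclic_by_finite_iff using T Y(3) by auto
qed

section \<open>Homomorphisms from presented groups\<close>

lemma hom_eq_on_generate:
  assumes "group G" "group K" "f \<in> hom G K" "g \<in> hom G K" "X \<subseteq> carrier G"
    and "\<And>x. x \<in> X \<Longrightarrow> f x = g x" "y \<in> generate G X"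
  shows "f y = g y"
proof -
  interpret G: group G by fact
  interpret f: group_hom G K f using assms by (intro group_hom.intro group_hom_axioms.intro)
  interpret g: group_hom G K g using assms by (intro group_hom.intro group_hom_axioms.intro)
  note c = G.generate_in_carrier[OF assms(5)]
  show ?thesis using assms(7)
  proof (induction rule: generate.induct)
    case (inv h)
    then have "h \<in> carrier G" using assms(5) by blast
    then show ?case using assms(6)[OF inv] by simp
  next
    case (eng h k)
    then show ?case using c by simp
  qed (use assms(6) in auto)
qed

text \<open>
  Evaluation of words is the homomorphism from the free group that extends \<open>\<phi>\<close>; homomorphisms from a
  presented group arise from it by passing to classes.
\<close>

definition word_eval :: "('k, 'c) monoid_scheme \<Rightarrow> ('g \<Rightarrow> 'k) \<Rightarrow> 'g word \<Rightarrow> 'k"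
  where "word_eval K \<phi> w =
    foldr (\<lambda>(x, b) k. (if b then \<phi> x else inv\<^bsub>K\<^esub> \<phi> x) \<otimes>\<^bsub>K\<^esub> k) w \<one>\<^bsub>K\<^esub>"

lemma word_eval_Nil [simp]: "word_eval K \<phi> [] = \<one>\<^bsub>K\<^esub>"
  by (simp add: word_eval_def)

lemma word_eval_Cons [simp]:
  "word_eval K \<phi> ((x, b) # w) = (if b then \<phi> x else inv\<^bsub>K\<^esub> \<phi> x) \<otimes>\<^bsub>K\<^esub> word_eval K \<phi> w"
  by (simp add: word_eval_def)

context group
begin

lemma word_eval_closed [simp]:
  "\<phi> \<in> S \<rightarrow> carrier G \<Longrightarrow> w \<in> words S \<Longrightarrow> word_eval G \<phi> w \<in> carrier G"
  by (induction w) (auto simp: Pi_iff)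

lemma word_eval_append [simp]:
  assumes "\<phi> \<in> S \<rightarrow> carrier G"
  shows "u \<in> words S \<Longrightarrow> v \<in> words S \<Longrightarrow>
    word_eval G \<phi> (u @ v) = word_eval G \<phi> u \<otimes> word_eval G \<phi> v"
proof (induction u)
  case (Cons a u)
  obtain x b where a: "a = (x, b)" by (cases a)
  have "\<phi> x \<in> carrier G" using Cons.prems a assms by auto
  then show ?case using Cons a word_eval_closed[OF assms] by (simp add: m_assoc)
qed (use word_eval_closed[OF assms] in simp)

lemma word_eval_gen [simp]: "\<phi> x \<in> carrier G \<Longrightarrow> word_eval G \<phi> (gen x) = \<phi> x"
  by (simp add: gen_def)

lemma word_eval_word_inv [simp]:
  assumes "\<phi> \<in> S \<rightarrow> carrier G"
  shows "w \<in> words S \<Longrightarrow> word_eval G \<phi> (word_inv w) = inv (word_eval G \<phi> w)"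
proof (induction w)
  case Nil
  then show ?case by (simp add: word_inv_def)
next
  case (Cons a w)
  obtain x b where a: "a = (x, b)" by (cases a)
  have x: "x \<in> S" "w \<in> words S" "\<phi> x \<in> carrier G" using Cons.prems a assms by auto
  have "word_inv (a # w) = word_inv w @ [(x, \<not> b)]" by (simp add: word_inv_def a)
  then show ?case using Cons.IH[OF x(2)] a x word_eval_append[OF assms, of "word_inv w" "[(x, \<not> b)]"]
      word_eval_closed[OF assms]
    by (simp add: inv_mult_group)
qed

lemma word_eval_word_conj [simp]:
  assumes "\<phi> \<in> S \<rightarrow> carrier G" "u \<in> words S" "v \<in> words S"
  shows "word_eval G \<phi> (word_conj u v) = gconj G (word_eval G \<phi> u) (word_eval G \<phi> v)"
  using word_eval_closed[OF assms(1)] assms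
  by (simp add: word_conj_def gconj_def word_eval_append[OF assms(1)] word_eval_word_inv[OF assms(1)] m_assoc)

end

lemma gen_in_words [simp]: "gen x \<in> words S \<longleftrightarrow> x \<in> S"
  by (simp add: gen_def)

lemma word_conj_in_words [simp]: "word_conj u v \<in> words S \<longleftrightarrow> u \<in> words S \<and> v \<in> words S"
  by (auto simp: word_conj_def)

lemma word_comm_in_words [simp]: "word_comm u v \<in> words S \<longleftrightarrow> u \<in> words S \<and> v \<in> words S"
  by (auto simp: word_comm_def)

definition group_commutator :: "('a, 'b) monoid_scheme \<Rightarrow> 'a \<Rightarrow> 'a \<Rightarrow> 'a"
  where "group_commutator G x y = inv\<^bsub>G\<^esub> x \<otimes>\<^bsub>G\<^esub> inv\<^bsub>G\<^esub> y \<otimes>\<^bsub>G\<^esub> x \<otimes>\<^bsub>G\<^esub> y"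

lemma (in group) word_eval_word_comm [simp]:
  assumes "\<phi> \<in> S \<rightarrow> carrier G" "u \<in> words S" "v \<in> words S"
  shows "word_eval G \<phi> (word_comm u v) = group_commutator G (word_eval G \<phi> u) (word_eval G \<phi> v)"
  using word_eval_closed[OF assms(1)] assms
  by (simp add: word_comm_def group_commutator_def word_eval_append[OF assms(1)]
      word_eval_word_inv[OF assms(1)] m_assoc)

abbreviation word_class :: "'g set \<Rightarrow> ('g word \<times> 'g word) set \<Rightarrow> 'g word \<Rightarrow> 'g word set"
  where "word_class S R w \<equiv> word_rel S R `` {w}"

lemma word_class_eq_iff:
  assumes "u \<in> words S" "v \<in> words S"
  shows "word_class S R u = word_class S R v \<longleftrightarrow> word_cong S R u v"
  using eq_equiv_class_iff[OF equiv_word_rel assms] by (simp add: word_rel_def)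

lemma carrier_presented_group: "carrier (presented_group S R) = word_class S R ` words S"
  by (auto simp: presented_group_def quotient_def)

lemma one_presented_group: "\<one>\<^bsub>presented_group S R\<^esub> = word_class S R []"
  by (simp add: presented_group_def)

lemma word_eval_word_class:
  assumes "w \<in> words S"
  shows "word_eval (presented_group S R) (\<lambda>x. word_class S R (gen x)) w = word_class S R w"
proof -
  interpret P: group "presented_group S R" by (rule group_presented_group)
  show ?thesis using assms
  proof (induction w)
    case Nil
    then show ?case by (simp add: one_presented_group)
  next
    case (Cons a w)
    obtain x b where a: "a = (x, b)" by (cases a)
    have x: "x \<in> S" "w \<in> words S" using Cons.prems a by auto
    have "word_class S R [(x, False)] \<otimes>\<^bsub>presented_group S R\<^esub> word_class S R (gen x) =
      \<one>\<^bsub>presented_group S R\<^esub>"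
      using x word_cong.cancel[OF x(1), of R False]
      by (subst presented_group_mult_class) (auto simp: one_presented_group word_class_eq_iff gen_def)
    then have "inv\<^bsub>presented_group S R\<^esub> (word_class S R (gen x)) = word_class S R [(x, False)]"
      using x by (intro P.inv_equality) (auto simp: carrier_presented_group)
    moreover have "word_class S R [(x, b)] \<otimes>\<^bsub>presented_group S R\<^esub> word_class S R w = word_class S R (a # w)"
      using x presented_group_mult_class[of "[(x, b)]" S w R] by (simp add: a)
    ultimately show ?case using Cons.IH[OF x(2)] a by (cases b) (auto simp: gen_def)
  qed
qed

lemma presented_group_generators:
  "generate (presented_group S R) ((\<lambda>x. word_class S R (gen x)) ` S) = carrier (presented_group S R)"
    (is "generate ?P ?X = _")
proof
  interpret P: group ?P by (rule group_presented_group)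
  have X: "?X \<subseteq> carrier ?P" by (auto simp: carrier_presented_group)
  show "generate ?P ?X \<subseteq> carrier ?P" by (rule P.generate_incl[OF X])
  have "word_eval ?P (\<lambda>x. word_class S R (gen x)) w \<in> generate ?P ?X" if "w \<in> words S" for w
    using that
  proof (induction w)
    case (Cons a w)
    obtain x b where a: "a = (x, b)" by (cases a)
    then show ?case using Cons
      by (auto intro!: generate.eng intro: generate.incl generate.inv)
  qed (simp add: generate.one)
  then show "carrier ?P \<subseteq> generate ?P ?X"
    by (auto simp: carrier_presented_group word_eval_word_class)
qed

lemma presented_group_relation:
  assumes "(u, v) \<in> R" "u \<in> words S" "v \<in> words S"
  shows "word_eval (presented_group S R) (\<lambda>x. word_class S R (gen x)) u =
    word_eval (presented_group S R) (\<lambda>x. word_class S R (gen x)) v"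
  using assms by (simp add: word_eval_word_class word_class_eq_iff word_cong.relation)

lemma presented_group_lift:
  assumes K: "group K" and \<phi>: "\<phi> \<in> S \<rightarrow> carrier K"
    and rel: "\<And>u v. (u, v) \<in> R \<Longrightarrow> u \<in> words S \<Longrightarrow> v \<in> words S \<Longrightarrow> word_eval K \<phi> u = word_eval K \<phi> v"
  obtains F where "F \<in> hom (presented_group S R) K"
    "\<And>x. x \<in> S \<Longrightarrow> F (word_class S R (gen x)) = \<phi> x"
proof -
  interpret K: group K by fact
  have cong: "word_cong S R u v \<Longrightarrow> word_eval K \<phi> u = word_eval K \<phi> v" for u v
  proof (induction rule: word_cong.induct)
    case (append u u' v v')
    then show ?case
      using word_cong_words[OF append(1)] word_cong_words[OF append(2)] K.word_eval_append[OF \<phi>] by simp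
  next
    case (cancel x b)
    then have "\<phi> x \<in> carrier K" using \<phi> by blast
    then show ?case by simp
  qed (use rel in auto)
  define F where "F A = word_eval K \<phi> (SOME w. w \<in> A)" for A
  have F: "F (word_class S R w) = word_eval K \<phi> w" if "w \<in> words S" for w
  proof -
    have "w \<in> word_class S R w" using that by (simp add: word_rel_def word_cong.refl)
    then have "(SOME v. v \<in> word_class S R w) \<in> word_class S R w" by (rule someI)
    then have "word_cong S R w (SOME v. v \<in> word_class S R w)" by (simp add: word_rel_def)
    then show ?thesis unfolding F_def by (rule cong[symmetric])
  qed
  have "F \<in> hom (presented_group S R) K"
  proof (rule homI)
    fix A B assume "A \<in> carrier (presented_group S R)" "B \<in> carrier (presented_group S R)"
    then show "F (A \<otimes>\<^bsub>presented_group S R\<^esub> B) = F A \<otimes>\<^bsub>K\<^esub> F B"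
      by (auto simp: carrier_presented_group presented_group_mult_class F K.word_eval_append[OF \<phi>])
  qed (auto simp: carrier_presented_group F K.word_eval_closed[OF \<phi>])
  moreover have "F (word_class S R (gen x)) = \<phi> x" if "x \<in> S" for x
    using that \<phi> by (subst F) (auto intro: K.word_eval_gen)
  ultimately show ?thesis using that by blast
qed

section \<open>Conjugation and commutators\<close>

context group
begin

lemma gconj_closed [simp]: "x \<in> carrier G \<Longrightarrow> y \<in> carrier G \<Longrightarrow> gconj G x y \<in> carrier G"
  by (simp add: gconj_def)

lemma gconj_mult:
  assumes "x \<in> carrier G" "y \<in> carrier G" "z \<in> carrier G"
  shows "gconj G (x \<otimes> y) z = gconj G x z \<otimes> gconj G y z"
  using assms by (simp add: gconj_def m_assoc)

lemma gconj_gconj: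
  assumes "x \<in> carrier G" "y \<in> carrier G" "z \<in> carrier G"
  shows "gconj G (gconj G x y) z = gconj G x (y \<otimes> z)"
  using assms by (simp add: gconj_def m_assoc inv_mult_group)

lemma gconj_one [simp]: "x \<in> carrier G \<Longrightarrow> gconj G x \<one> = x" "x \<in> carrier G \<Longrightarrow> gconj G \<one> x = \<one>"
  by (simp_all add: gconj_def)

lemma gconj_distrib:
  assumes "x \<in> carrier G" "y \<in> carrier G" "z \<in> carrier G"
  shows "gconj G (gconj G x y) z = gconj G (gconj G x z) (gconj G y z)"
  using assms by (simp add: gconj_def m_assoc inv_mult_group)

lemma mult_gconj_eq:
  assumes "x \<in> carrier G" "y \<in> carrier G"
  shows "y \<otimes> gconj G x y = x \<otimes> y"
  using assms by (simp add: gconj_def m_assoc)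

lemma gconj_hom: "z \<in> carrier G \<Longrightarrow> (\<lambda>x. gconj G x z) \<in> hom G G"
  by (rule homI) (simp_all add: gconj_mult)

lemma group_commutator_closed [simp]:
  "x \<in> carrier G \<Longrightarrow> y \<in> carrier G \<Longrightarrow> group_commutator G x y \<in> carrier G"
  by (simp add: group_commutator_def)

lemma group_commutator_eq:
  assumes "x \<in> carrier G" "y \<in> carrier G"
  shows "group_commutator G x y = inv x \<otimes> gconj G x y"
  using assms by (simp add: group_commutator_def gconj_def m_assoc)

lemma gconj_group_commutator:
  assumes "x \<in> carrier G" "y \<in> carrier G" "z \<in> carrier G"
  shows "gconj G (group_commutator G x y) z = group_commutator G (gconj G x z) (gconj G y z)"
  using assms by (simp add: gconj_def group_commutator_def m_assoc inv_mult_group)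

lemma group_commutator_mult_left:
  assumes "x \<in> carrier G" "y \<in> carrier G" "z \<in> carrier G"
  shows "group_commutator G (x \<otimes> y) z = gconj G (group_commutator G x z) y \<otimes> group_commutator G y z"
  using assms by (simp add: gconj_def group_commutator_def m_assoc inv_mult_group)

lemma group_commutator_mult_right:
  assumes "x \<in> carrier G" "y \<in> carrier G" "z \<in> carrier G"
  shows "group_commutator G x (y \<otimes> z) = group_commutator G x z \<otimes> gconj G (group_commutator G x y) z"
  using assms by (simp add: gconj_def group_commutator_def m_assoc inv_mult_group)

end

section \<open>Crossed pairings\<close>

text \<open>
  The identities satisfied by \<open>x \<otimes> y\<close> in the tensor square, for an arbitrary target group. They
  also hold for commutators, in \<open>H\<close> and between the two copies of \<open>H\<close> in \<open>\<nu>(H)\<close>, so that both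
  commutator maps extend to homomorphisms on the tensor square.
\<close>

definition crossed_pairing ::
  "('a, 'b) monoid_scheme \<Rightarrow> ('t, 'u) monoid_scheme \<Rightarrow> ('a \<Rightarrow> 'a \<Rightarrow> 't) \<Rightarrow> bool"
  where "crossed_pairing H T \<tau> \<longleftrightarrow>
    (\<forall>x\<in>carrier H. \<forall>y\<in>carrier H. \<tau> x y \<in> carrier T) \<and>
    (\<forall>x\<in>carrier H. \<forall>y\<in>carrier H. \<forall>z\<in>carrier H.
      \<tau> (x \<otimes>\<^bsub>H\<^esub> y) z = \<tau> (gconj H x y) (gconj H z y) \<otimes>\<^bsub>T\<^esub> \<tau> y z \<and>
      \<tau> x (y \<otimes>\<^bsub>H\<^esub> z) = \<tau> x z \<otimes>\<^bsub>T\<^esub> \<tau> (gconj H x z) (gconj H y z))"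

lemma (in group) crossed_pairing_group_commutator: "crossed_pairing G G (group_commutator G)"
  by (simp add: crossed_pairing_def group_commutator_mult_left group_commutator_mult_right
      gconj_group_commutator)

lemma (in group) crossed_pairing_gconj:
  assumes "crossed_pairing G T \<tau>" "h \<in> carrier G"
  shows "crossed_pairing G T (\<lambda>x y. \<tau> (gconj G x h) (gconj G y h))"
  using assms by (simp add: crossed_pairing_def gconj_mult gconj_distrib [of _ _ h])

text \<open>
  The structure of the tensor square that matters: it is generated by a pairing, \<open>H\<close> acts on it through
  conjugation of both arguments (from the right, see \<open>act_act\<close>), and the commutator map is a
  homomorphism \<open>\<kappa>\<close> to \<open>H\<close>. From the pairing identities
  alone follow the Peiffer identity of a crossed module and a formula for the action in terms of \<open>\<kappa>\<close>.
\<close>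

locale equivariant_pairing = H: group H + T: group T
  for H :: "('a, 'b) monoid_scheme" (structure) and T :: "('t, 'u) monoid_scheme" +
  fixes \<tau> :: "'a \<Rightarrow> 'a \<Rightarrow> 't" and act :: "'a \<Rightarrow> 't \<Rightarrow> 't" and \<kappa> :: "'t \<Rightarrow> 'a"
  assumes pairing: "crossed_pairing H T \<tau>"
    and generators: "generate T {\<tau> x y |x y. x \<in> carrier H \<and> y \<in> carrier H} = carrier T"
    and act_hom: "\<And>h. h \<in> carrier H \<Longrightarrow> act h \<in> hom T T"
    and act_\<tau>: "\<And>h x y. h \<in> carrier H \<Longrightarrow> x \<in> carrier H \<Longrightarrow> y \<in> carrier H \<Longrightarrow>
      act h (\<tau> x y) = \<tau> (gconj H x h) (gconj H y h)"
    and \<kappa>_hom: "\<kappa> \<in> hom T H"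
    and \<kappa>_\<tau>: "\<And>x y. x \<in> carrier H \<Longrightarrow> y \<in> carrier H \<Longrightarrow> \<kappa> (\<tau> x y) = group_commutator H x y"
begin

lemma \<tau>_closed [simp]: "x \<in> carrier H \<Longrightarrow> y \<in> carrier H \<Longrightarrow> \<tau> x y \<in> carrier T"
  using pairing by (simp add: crossed_pairing_def)

lemma \<tau>_mult_left:
  assumes "x \<in> carrier H" "y \<in> carrier H" "z \<in> carrier H"
  shows "\<tau> (x \<otimes> y) z = \<tau> (gconj H x y) (gconj H z y) \<otimes>\<^bsub>T\<^esub> \<tau> y z"
  using pairing assms by (simp add: crossed_pairing_def)

lemma \<tau>_mult_right:
  assumes "x \<in> carrier H" "y \<in> carrier H" "z \<in> carrier H"
  shows "\<tau> x (y \<otimes> z) = \<tau> x z \<otimes>\<^bsub>T\<^esub> \<tau> (gconj H x z) (gconj H y z)"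
  using pairing assms by (simp add: crossed_pairing_def)

sublocale \<kappa>: group_hom T H \<kappa>
  by unfold_locales (rule \<kappa>_hom)

lemma act_group_hom: "h \<in> carrier H \<Longrightarrow> group_hom T T (act h)"
  by unfold_locales (rule act_hom)

lemmas act_closed [simp] = group_hom.hom_closed[OF act_group_hom]
lemmas act_mult = group_hom.hom_mult[OF act_group_hom]
lemmas act_inv = group_hom.hom_inv[OF act_group_hom]
lemmas act_one [simp] = group_hom.hom_one[OF act_group_hom]

lemma hom_eqI:
  assumes "group K" "f \<in> hom T K" "g \<in> hom T K"
    and "\<And>x y. x \<in> carrier H \<Longrightarrow> y \<in> carrier H \<Longrightarrow> f (\<tau> x y) = g (\<tau> x y)" "t \<in> carrier T"
  shows "f t = g t"
proof (rule hom_eq_on_generate[OF T.group_axioms assms(1-3)])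
  show "t \<in> generate T {\<tau> x y |x y. x \<in> carrier H \<and> y \<in> carrier H}"
    using assms(5) generators by simp
qed (use assms(4) in auto)

lemma carrier_induct [consumes 1, case_names one \<tau> inv mult]:
  assumes "t \<in> carrier T" "P \<one>\<^bsub>T\<^esub>"
    and "\<And>x y. x \<in> carrier H \<Longrightarrow> y \<in> carrier H \<Longrightarrow> P (\<tau> x y)"
    and inv: "\<And>t. t \<in> carrier T \<Longrightarrow> P t \<Longrightarrow> P (inv\<^bsub>T\<^esub> t)"
    and mult: "\<And>s t. s \<in> carrier T \<Longrightarrow> t \<in> carrier T \<Longrightarrow> P s \<Longrightarrow> P t \<Longrightarrow> P (s \<otimes>\<^bsub>T\<^esub> t)"
  shows "P t"
proof -
  have "t \<in> generate T {\<tau> x y |x y. x \<in> carrier H \<and> y \<in> carrier H}"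
    using assms(1) generators by simp
  then show ?thesis
  proof (induction rule: generate.induct)
    case (eng s t)
    then show ?case using mult generators by simp
  qed (use assms in auto)
qed

lemma act_act:
  assumes "g \<in> carrier H" "h \<in> carrier H" "t \<in> carrier T"
  shows "act h (act g t) = act (g \<otimes> h) t"
proof -
  have "(act h \<circ> act g) t = act (g \<otimes> h) t"
  proof (rule hom_eqI[where f = "act h \<circ> act g" and g = "act (g \<otimes> h)"])
    show "act h \<circ> act g \<in> hom T T" using assms by (intro hom_compose[of _ _ T] act_hom)
    show "act (g \<otimes> h) \<in> hom T T" using assms by (intro act_hom H.m_closed)
  qed (use assms T.group_axioms in \<open>auto simp: act_\<tau> H.gconj_gconj\<close>)
  then show ?thesis by simp
qed

lemma act_by_one [simp]:
  assumes "t \<in> carrier T"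
  shows "act \<one> t = t"
proof (rule hom_eqI[where f = "act \<one>" and g = "\<lambda>t. t"])
  show "act \<one> \<in> hom T T" by (rule act_hom) simp
  show "(\<lambda>t. t) \<in> hom T T" by (simp add: hom_def)
qed (use assms T.group_axioms in \<open>auto simp: act_\<tau>\<close>)

lemma \<tau>_one [simp]:
  assumes "z \<in> carrier H"
  shows "\<tau> \<one> z = \<one>\<^bsub>T\<^esub>" "\<tau> z \<one> = \<one>\<^bsub>T\<^esub>"
proof -
  have "\<tau> \<one> z = \<tau> \<one> z \<otimes>\<^bsub>T\<^esub> \<tau> \<one> z" "\<tau> z \<one> = \<tau> z \<one> \<otimes>\<^bsub>T\<^esub> \<tau> z \<one>"
    using \<tau>_mult_left[of \<one> \<one> z] \<tau>_mult_right[of z \<one> \<one>] assms by simp_all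
  then show "\<tau> \<one> z = \<one>\<^bsub>T\<^esub>" "\<tau> z \<one> = \<one>\<^bsub>T\<^esub>"
    using T.l_cancel_one'[of "\<tau> \<one> z" "\<tau> \<one> z"] T.l_cancel_one'[of "\<tau> z \<one>" "\<tau> z \<one>"] assms
    by simp_all
qed

text \<open>
  Expanding \<open>\<tau> (x a) (y b)\<close> first in the left and then in the right argument, or in the opposite order,
  produces the same outer factors \<open>?l\<close> and \<open>?r\<close>. Cancelling them leaves this identity.
\<close>

lemma double_expansion:
  assumes "x \<in> carrier H" "y \<in> carrier H" "a \<in> carrier H" "b \<in> carrier H"
  shows "act (b \<otimes> a) (\<tau> x y) \<otimes>\<^bsub>T\<^esub> \<tau> a b = \<tau> a b \<otimes>\<^bsub>T\<^esub> act (a \<otimes> b) (\<tau> x y)"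
proof -
  let ?l = "\<tau> (gconj H x a) (gconj H b a)" and ?r = "\<tau> (gconj H a b) (gconj H y b)"
  have "a \<otimes> gconj H b a = b \<otimes> a" "b \<otimes> gconj H a b = a \<otimes> b"
    using assms by (simp_all add: H.mult_gconj_eq)
  then have e: "gconj H (gconj H z a) (gconj H b a) = gconj H z (b \<otimes> a)"
    "gconj H (gconj H z b) (gconj H a b) = gconj H z (a \<otimes> b)" if "z \<in> carrier H" for z
    using that assms by (simp_all add: H.gconj_gconj)
  have "\<tau> (x \<otimes> a) (y \<otimes> b) = \<tau> (gconj H x a) (gconj H y a \<otimes> gconj H b a) \<otimes>\<^bsub>T\<^esub> \<tau> a (y \<otimes> b)"
    using assms by (simp add: \<tau>_mult_left H.gconj_mult)
  also have "\<dots> = ?l \<otimes>\<^bsub>T\<^esub> (act (b \<otimes> a) (\<tau> x y) \<otimes>\<^bsub>T\<^esub> \<tau> a b) \<otimes>\<^bsub>T\<^esub> ?r"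
    using assms by (simp add: \<tau>_mult_right e act_\<tau> T.m_assoc)
  finally have 1: "\<tau> (x \<otimes> a) (y \<otimes> b) = \<dots>" .
  have "\<tau> (x \<otimes> a) (y \<otimes> b) = \<tau> (x \<otimes> a) b \<otimes>\<^bsub>T\<^esub> \<tau> (gconj H x b \<otimes> gconj H a b) (gconj H y b)"
    using assms by (simp add: \<tau>_mult_right H.gconj_mult)
  also have "\<dots> = ?l \<otimes>\<^bsub>T\<^esub> (\<tau> a b \<otimes>\<^bsub>T\<^esub> act (a \<otimes> b) (\<tau> x y)) \<otimes>\<^bsub>T\<^esub> ?r"
    using assms by (simp add: \<tau>_mult_left e act_\<tau> T.m_assoc)
  finally show ?thesis using 1 assms by simp
qed

lemma conj_by_\<tau>:
  assumes "a \<in> carrier H" "b \<in> carrier H" "s \<in> carrier T"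
  shows "gconj T s (\<tau> a b) = act (group_commutator H a b) s"
proof (rule hom_eqI[where f = "\<lambda>s. gconj T s (\<tau> a b)" and g = "act (group_commutator H a b)", OF T.group_axioms T.gconj_hom act_hom])
  fix x y assume xy: "x \<in> carrier H" "y \<in> carrier H"
  \<comment> \<open>The twist by ?c turns the left action in the double expansion into the trivial one and the right
    action into the action of the commutator of a and b.\<close>
  let ?c = "inv (b \<otimes> a)"
  have c: "?c \<in> carrier H" "?c \<otimes> (a \<otimes> b) = group_commutator H a b" "?c \<otimes> (b \<otimes> a) = \<one>"
    using assms by (simp_all add: group_commutator_def H.inv_mult_group H.m_assoc)
  have "act (b \<otimes> a) (\<tau> (gconj H x ?c) (gconj H y ?c)) = \<tau> x y"
    "act (a \<otimes> b) (\<tau> (gconj H x ?c) (gconj H y ?c)) = act (group_commutator H a b) (\<tau> x y)"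
    using xy c assms(1,2) by (simp_all only: act_\<tau> [symmetric] act_act H.m_closed \<tau>_closed act_by_one)
  then have "\<tau> x y \<otimes>\<^bsub>T\<^esub> \<tau> a b = \<tau> a b \<otimes>\<^bsub>T\<^esub> act (group_commutator H a b) (\<tau> x y)"
    using double_expansion[of "gconj H x ?c" "gconj H y ?c" a b] xy c assms by simp
  then show "gconj T (\<tau> x y) (\<tau> a b) = act (group_commutator H a b) (\<tau> x y)"
    using xy assms by (simp add: gconj_def T.m_assoc)
qed (use assms in auto)

text \<open>
  The Peiffer identity: conjugation inside \<open>T\<close> is the action through \<open>\<kappa>\<close>. Both sides are multiplicative in
  \<open>t\<close>, so the case of generators suffices.
\<close>

lemma peiffer:
  assumes "t \<in> carrier T" "s \<in> carrier T"
  shows "gconj T s t = act (\<kappa> t) s"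
  using assms
proof (induction arbitrary: s rule: carrier_induct)
  case (\<tau> x y)
  then show ?case by (simp add: conj_by_\<tau> \<kappa>_\<tau>)
next
  case (inv t)
  let ?s = "gconj T s (inv\<^bsub>T\<^esub> t)"
  have s: "?s \<in> carrier T" "gconj T ?s t = s" using inv(1,3) by (simp_all add: T.gconj_gconj)
  have "act (\<kappa> t) ?s = s" using inv.IH[OF s(1)] s(2) by simp
  then have "act (inv (\<kappa> t)) s = act (inv (\<kappa> t)) (act (\<kappa> t) ?s)" by simp
  also have "\<dots> = ?s" using inv(1) s(1) by (simp add: act_act)
  finally show ?case using inv(1) by simp
next
  case (mult t t')
  then show ?case by (simp add: act_act T.gconj_gconj [symmetric])
qed simp

lemma \<tau>_inv_left:
  assumes "x \<in> carrier H" "z \<in> carrier H"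
  shows "\<tau> (inv x) z = act (inv x) (inv\<^bsub>T\<^esub> \<tau> x z)"
proof -
  have "act (inv x) (\<tau> x z) \<otimes>\<^bsub>T\<^esub> \<tau> (inv x) z = \<one>\<^bsub>T\<^esub>"
    using \<tau>_mult_left[of x "inv x" z] assms by (simp add: act_\<tau>)
  then have "inv\<^bsub>T\<^esub> (act (inv x) (\<tau> x z)) = \<tau> (inv x) z"
    using assms by (intro T.inv_equality) (simp_all add: T.inv_comm)
  then show ?thesis using assms by (simp add: act_inv)
qed

text \<open>
  Write \<open>[x, y] = x\<inverse> x\<^sup>y\<close> and expand \<open>\<tau> [x, y] z\<close> in its left argument. The first factor is a conjugate of
  \<open>(\<tau> x z)\<inverse>\<close> by \<open>conj_by_\<tau>\<close>. The second factor is found by comparing the expansions of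
  \<open>\<tau> x (w y)\<close> and \<open>\<tau> x (y z)\<close>, where \<open>w = y z y\<inverse>\<close> makes the two arguments equal.
\<close>

lemma act_\<tau>_eq:
  assumes "x \<in> carrier H" "y \<in> carrier H" "z \<in> carrier H"
  shows "act z (\<tau> x y) = \<tau> x y \<otimes>\<^bsub>T\<^esub> \<tau> (group_commutator H x y) z"
proof -
  let ?w = "gconj H z (inv y)"
  have w: "?w \<in> carrier H" "gconj H ?w y = z" "?w \<otimes> y = y \<otimes> z"
    using assms by (simp_all add: H.gconj_gconj) (simp add: gconj_def H.m_assoc)
  have 1: "\<tau> x y \<otimes>\<^bsub>T\<^esub> \<tau> (gconj H x y) z = \<tau> x z \<otimes>\<^bsub>T\<^esub> act z (\<tau> x y)"
    using \<tau>_mult_right[of x ?w y] \<tau>_mult_right[of x y z] assms w by (simp add: act_\<tau>)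
  have "act (gconj H x y) (\<tau> (inv x) z) = gconj T (inv\<^bsub>T\<^esub> \<tau> x z) (\<tau> x y)"
    using assms by (simp add: \<tau>_inv_left act_act H.group_commutator_eq [symmetric] conj_by_\<tau>)
  then have 2: "\<tau> (group_commutator H x y) z =
    gconj T (inv\<^bsub>T\<^esub> \<tau> x z) (\<tau> x y) \<otimes>\<^bsub>T\<^esub> \<tau> (gconj H x y) z"
    using \<tau>_mult_left[of "inv x" "gconj H x y" z] assms by (simp add: H.group_commutator_eq act_\<tau>)
  have "\<tau> x y \<otimes>\<^bsub>T\<^esub> \<tau> (group_commutator H x y) z =
    inv\<^bsub>T\<^esub> \<tau> x z \<otimes>\<^bsub>T\<^esub> (\<tau> x y \<otimes>\<^bsub>T\<^esub> \<tau> (gconj H x y) z)"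
    unfolding 2 using assms by (simp add: gconj_def T.m_assoc)
  then show ?thesis unfolding 1 using assms by simp
qed

text \<open>
  The displacement of \<open>t\<close> under \<open>h\<close> depends only on \<open>\<kappa> t\<close>. So \<open>H\<close> acts trivially on the kernel of
  \<open>\<kappa>\<close>, a fact that does not follow from the Peiffer identity.
\<close>

lemma act_eq:
  assumes "t \<in> carrier T" "h \<in> carrier H"
  shows "act h t = t \<otimes>\<^bsub>T\<^esub> \<tau> (\<kappa> t) h"
  using assms(1)
proof (induction rule: carrier_induct)
  case (\<tau> x y)
  then show ?case using act_\<tau>_eq assms(2) by (simp add: \<kappa>_\<tau>)
next
  case (inv t)
  have "\<tau> (\<kappa> (inv\<^bsub>T\<^esub> t)) h = gconj T (inv\<^bsub>T\<^esub> \<tau> (\<kappa> t) h) (inv\<^bsub>T\<^esub> t)"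
    using inv assms(2) by (simp add: \<tau>_inv_left peiffer)
  then show ?case using inv assms(2) by (simp add: act_inv gconj_def T.inv_mult_group T.m_assoc)
next
  case (mult s t)
  have "\<tau> (\<kappa> (s \<otimes>\<^bsub>T\<^esub> t)) h = gconj T (\<tau> (\<kappa> s) h) t \<otimes>\<^bsub>T\<^esub> \<tau> (\<kappa> t) h"
    using mult assms(2) by (simp add: \<tau>_mult_left peiffer act_\<tau>)
  then show ?case using mult assms(2) by (simp add: act_mult gconj_def T.m_assoc)
qed (use assms(2) in simp)

lemma kernel_fixed:
  assumes "t \<in> carrier T" "\<kappa> t = \<one>" "h \<in> carrier H"
  shows "act h t = t"
  using act_eq[of t h] assms by simp

lemma kernel_central:
  assumes "t \<in> carrier T" "\<kappa> t = \<one>" "s \<in> carrier T"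
  shows "t \<otimes>\<^bsub>T\<^esub> s = s \<otimes>\<^bsub>T\<^esub> t"
proof -
  have "gconj T s t = s" using peiffer[of t s] assms by simp
  then have "t \<otimes>\<^bsub>T\<^esub> gconj T s t = t \<otimes>\<^bsub>T\<^esub> s" by simp
  then show ?thesis using assms by (simp add: T.mult_gconj_eq)
qed

text \<open>
  The \<open>\<tau> x y\<close> with \<open>x\<close>, \<open>y\<close> in a symmetric generating set of \<open>H\<close> generate \<open>T\<close> together with their
  images under \<open>H\<close>, so it suffices to find a finite set that contains them and whose span \<open>M\<close> is
  invariant under \<open>H\<close>. Start from a finite set \<open>E\<close> that contains
  these elements and generates \<open>T\<close> modulo the kernel of \<open>\<kappa>\<close>. The image of an element of \<open>E\<close> under a
  generator of \<open>H\<close> differs from an element of \<open>\<langle>E\<rangle>\<close> by a factor \<open>j\<close> in the kernel. Adjoining these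
  finitely many factors is enough, because \<open>H\<close> fixes the kernel pointwise.
\<close>

lemma finitely_generated:
  assumes X: "finite X" "X \<subseteq> carrier H" "generate H X = carrier H"
    and F: "finite F" "F \<subseteq> \<kappa> ` carrier T" "\<kappa> ` carrier T = generate H F"
  shows "\<exists>Y. finite Y \<and> Y \<subseteq> carrier T \<and> generate T Y = carrier T"
proof -
  \<comment> \<open>The set is made symmetric so that invariance under its elements passes to all of H.\<close>
  define X' where "X' = X \<union> (\<lambda>x. inv x) ` X"
  have X': "finite X'" "X' \<subseteq> carrier H" using X by (auto simp: X'_def)
  obtain L where L: "L \<subseteq> carrier T" "finite L" "F = \<kappa> ` L"
    using finite_subset_image[OF F(1,2)] by metis
  define E where "E = L \<union> (\<lambda>(x, y). \<tau> x y) ` (X' \<times> X')"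
  have X'_carrier: "x \<in> carrier H" if "x \<in> X'" for x using that X'(2) by blast
  have E: "finite E" "E \<subseteq> carrier T" using L(1,2) X'(1) X'_carrier by (auto simp: E_def)
  have E_carrier: "f \<in> carrier T" if "f \<in> E" for f using that E(2) by blast
  have "\<exists>m\<in>generate T E. \<kappa> m = \<kappa> t" if "t \<in> carrier T" for t
  proof -
    have "\<kappa> t \<in> generate H (\<kappa> ` L)" using F(3) L(3) that by blast
    also have "\<dots> \<subseteq> generate H (\<kappa> ` E)" by (rule H.mono_generate) (auto simp: E_def)
    also have "\<dots> = \<kappa> ` generate T E" using \<kappa>.generate_img[OF E(2)] by simp
    finally show ?thesis by auto
  qed
  then obtain m where m: "\<And>t. t \<in> carrier T \<Longrightarrow> m t \<in> generate T E \<and> \<kappa> (m t) = \<kappa> t"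
    by metis
  have mc: "m t \<in> carrier T" if "t \<in> carrier T" for t
    using m[OF that] T.generate_in_carrier[OF E(2)] by blast
  define j where "j t = inv\<^bsub>T\<^esub> (m t) \<otimes>\<^bsub>T\<^esub> t" for t
  have j: "j t \<in> carrier T" "\<kappa> (j t) = \<one>" "m t \<otimes>\<^bsub>T\<^esub> j t = t" if "t \<in> carrier T" for t
    using that m mc by (simp_all add: j_def)
  define Y where "Y = E \<union> (\<lambda>(x, f). j (act x f)) ` (X' \<times> E)"
  have jY: "j (act x f) \<in> carrier T" "\<kappa> (j (act x f)) = \<one>" if "x \<in> X'" "f \<in> E" for x f
    using that X'_carrier E_carrier by (simp_all add: j)
  have Y: "finite Y" "Y \<subseteq> carrier T" using E X' jY by (auto simp: Y_def)
  let ?M = "generate T Y"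
  have M: "subgroup ?M T" by (rule T.generate_is_subgroup[OF Y(2)])
  have Mc: "t \<in> carrier T" if "t \<in> ?M" for t using that by (rule subgroup.mem_carrier[OF M])
  have act_Y: "act x y \<in> ?M" if x: "x \<in> X'" and y: "y \<in> Y" for x y
  proof (cases "y \<in> E")
    case True
    then have c: "act x y \<in> carrier T" using x X'_carrier E_carrier by simp
    have "m (act x y) \<in> ?M" using m[OF c] T.mono_generate[of E Y] by (auto simp: Y_def)
    moreover have "j (act x y) \<in> ?M" using x True by (intro generate.incl) (auto simp: Y_def)
    ultimately have "m (act x y) \<otimes>\<^bsub>T\<^esub> j (act x y) \<in> ?M" by (rule generate.eng)
    then show ?thesis using j(3)[OF c] by simp
  next
    case False
    then have "\<kappa> y = \<one>" using y jY by (auto simp: Y_def)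
    then have "act x y = y"
      using X'_carrier[OF x] y Y(2) by (intro kernel_fixed) auto
    then show ?thesis using generate.incl[OF y] by simp
  qed
  have act_M': "act x t \<in> ?M" if "x \<in> X'" "t \<in> ?M" for x t
  proof -
    have x: "x \<in> carrier H" using that(1) by (rule X'_carrier)
    have "act x ` ?M = generate T (act x ` Y)"
      by (rule group_hom.generate_img[OF act_group_hom[OF x] Y(2), symmetric])
    also have "\<dots> \<subseteq> ?M" using act_Y that(1) by (intro T.generate_subgroup_incl[OF _ M]) blast
    finally show ?thesis using that(2) by blast
  qed
  have gc: "h \<in> carrier H" if "h \<in> generate H X" for h using that X(3) by simp
  have act_M: "\<forall>t\<in>?M. act h t \<in> ?M" if "h \<in> generate H X" for h
    using that
  proof (induction rule: generate.induct)
    case (eng g h)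
    then show ?case using act_act[of g h] gc Mc by metis
  qed (use act_M' Mc in \<open>auto simp: X'_def\<close>)
  have left: "\<tau> h y \<in> ?M" if "y \<in> X'" "h \<in> generate H X" for h y
    using that(2)
  proof (induction rule: generate.induct)
    case one
    then show ?case using X'_carrier[OF that(1)] by (simp add: generate.one)
  next
    case (eng g h)
    have "y \<in> carrier H" using that(1) by (rule X'_carrier)
    then have "\<tau> (g \<otimes> h) y = act h (\<tau> g y) \<otimes>\<^bsub>T\<^esub> \<tau> h y"
      using gc[OF eng(1)] gc[OF eng(2)] by (simp add: \<tau>_mult_left act_\<tau>)
    then show ?case using act_M[OF eng(2)] eng by (simp add: generate.eng)
  qed (use that(1) in \<open>auto intro!: generate.incl simp: X'_def Y_def E_def\<close>)
  have "\<tau> h y \<in> ?M" if h: "h \<in> generate H X" and "y \<in> generate H X" for h y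
    using that(2)
  proof (induction rule: generate.induct)
    case one
    then show ?case using gc[OF h] by (simp add: generate.one)
  next
    case (eng y z)
    have "\<tau> h (y \<otimes> z) = \<tau> h z \<otimes>\<^bsub>T\<^esub> act z (\<tau> h y)"
      using gc[OF eng(1)] gc[OF eng(2)] gc[OF h] by (simp add: \<tau>_mult_right act_\<tau>)
    then show ?case using act_M[OF eng(2)] eng by (simp add: generate.eng)
  qed (use left h in \<open>auto simp: X'_def\<close>)
  then have "{\<tau> x y |x y. x \<in> carrier H \<and> y \<in> carrier H} \<subseteq> ?M" using X(3) by auto
  then have "generate T {\<tau> x y |x y. x \<in> carrier H \<and> y \<in> carrier H} \<subseteq> ?M"
    by (rule T.generate_subgroup_incl[OF _ M])
  then have "carrier T \<subseteq> ?M" by (simp only: generators)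
  moreover have "?M \<subseteq> carrier T" by (rule T.generate_incl[OF Y(2)])
  ultimately show ?thesis using Y by blast
qed

theorem polycyclic_by_finite:
  assumes "polycyclic_by_finite H"
  shows "polycyclic_by_finite T"
proof -
  obtain X where X: "finite X" "X \<subseteq> carrier H" "generate H X = carrier H"
    using H.subgroup_finitely_generated[OF assms H.subgroup_self] by metis
  obtain F where F: "finite F" "F \<subseteq> \<kappa> ` carrier T" "\<kappa> ` carrier T = generate H F"
    using H.subgroup_finitely_generated[OF assms \<kappa>.img_is_subgroup] by metis
  obtain Y where Y: "finite Y" "Y \<subseteq> carrier T" "generate T Y = carrier T"
    using finitely_generated[OF X F] by metis
  show ?thesis
  proof (rule T.polycyclic_by_finite_if_central_kernel[OF Y H.group_axioms assms, of "{\<kappa>}"])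
    show "z \<otimes>\<^bsub>T\<^esub> g = g \<otimes>\<^bsub>T\<^esub> z"
      if "z \<in> carrier T" "\<And>f. f \<in> {\<kappa>} \<Longrightarrow> f z = \<one>" "g \<in> carrier T" for z g
      using that by (intro kernel_central) auto
  qed (use \<kappa>_hom in auto)
qed

end

section \<open>The tensor square\<close>

definition tensor :: "('a, 'b) monoid_scheme \<Rightarrow> 'a \<Rightarrow> 'a \<Rightarrow> ('a \<times> 'a) word set"
  where "tensor H x y = word_class (carrier H \<times> carrier H) (tensor_relations H) (gen (x, y))"

context group
begin

lemma group_tensor_square: "group (tensor_square G)"
  unfolding tensor_square_def by (rule group_presented_group)

lemma tensor_generators:
  "generate (tensor_square G) {tensor G x y |x y. x \<in> carrier G \<and> y \<in> carrier G} =
    carrier (tensor_square G)"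
proof -
  have "{tensor G x y |x y. x \<in> carrier G \<and> y \<in> carrier G} =
    (\<lambda>p. word_class (carrier G \<times> carrier G) (tensor_relations G) (gen p)) ` (carrier G \<times> carrier G)"
    by (auto simp: tensor_def)
  then show ?thesis
    unfolding tensor_square_def by (simp only: presented_group_generators)
qed

lemma crossed_pairing_tensor: "crossed_pairing G (tensor_square G) (tensor G)"
proof -
  let ?S = "carrier G \<times> carrier G" and ?R = "tensor_relations G"
  let ?T = "presented_group ?S ?R" and ?c = "\<lambda>p. word_class ?S ?R (gen p)"
  interpret T: group ?T by (rule group_presented_group)
  have c: "?c \<in> ?S \<rightarrow> carrier ?T" by (auto simp: carrier_presented_group)
  have e: "word_eval ?T ?c (gen p) = ?c p" if "p \<in> ?S" for p
    using c that by (intro T.word_eval_gen) blast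
  have "?c (x \<otimes> y, z) = ?c (gconj G x y, gconj G z y) \<otimes>\<^bsub>?T\<^esub> ?c (y, z)"
    "?c (x, y \<otimes> z) = ?c (x, z) \<otimes>\<^bsub>?T\<^esub> ?c (gconj G x z, gconj G y z)"
    if xyz: "x \<in> carrier G" "y \<in> carrier G" "z \<in> carrier G" for x y z
  proof -
    have rel: "(gen (x \<otimes> y, z), gen (gconj G x y, gconj G z y) @ gen (y, z)) \<in> ?R"
      "(gen (x, y \<otimes> z), gen (x, z) @ gen (gconj G x z, gconj G y z)) \<in> ?R"
      using xyz unfolding tensor_relations_def by blast+
    note evals = presented_group_relation[OF rel(1), of ?S] presented_group_relation[OF rel(2), of ?S]
    show "?c (x \<otimes> y, z) = ?c (gconj G x y, gconj G z y) \<otimes>\<^bsub>?T\<^esub> ?c (y, z)"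
      "?c (x, y \<otimes> z) = ?c (x, z) \<otimes>\<^bsub>?T\<^esub> ?c (gconj G x z, gconj G y z)"
      using evals xyz by (simp_all add: e T.word_eval_append[OF c])
  qed
  then show ?thesis
    using c by (auto simp: crossed_pairing_def tensor_def tensor_square_def)
qed

lemma tensor_lift:
  assumes K: "group K" and \<beta>: "crossed_pairing G K \<beta>"
  obtains F where "F \<in> hom (tensor_square G) K"
    "\<And>x y. x \<in> carrier G \<Longrightarrow> y \<in> carrier G \<Longrightarrow> F (tensor G x y) = \<beta> x y"
proof -
  interpret K: group K by (rule K)
  let ?\<phi> = "\<lambda>(x, y). \<beta> x y"
  have \<phi>: "?\<phi> \<in> carrier G \<times> carrier G \<rightarrow> carrier K" using \<beta> by (auto simp: crossed_pairing_def)
  have e: "word_eval K ?\<phi> (gen (x, y)) = \<beta> x y" if "x \<in> carrier G" "y \<in> carrier G" for x y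
    using \<beta> that by (simp add: K.word_eval_gen crossed_pairing_def)
  have "word_eval K ?\<phi> u = word_eval K ?\<phi> v" if "(u, v) \<in> tensor_relations G" for u v
    using that \<beta> unfolding tensor_relations_def
    by (auto simp: e K.word_eval_append[OF \<phi>] crossed_pairing_def)
  then obtain F where "F \<in> hom (presented_group (carrier G \<times> carrier G) (tensor_relations G)) K"
    "\<And>p. p \<in> carrier G \<times> carrier G \<Longrightarrow>
      F (word_class (carrier G \<times> carrier G) (tensor_relations G) (gen p)) = ?\<phi> p"
    using presented_group_lift[OF K \<phi>, of "tensor_relations G"] by metis
  then show ?thesis using that[of F] by (auto simp: tensor_square_def tensor_def)
qed

lemma equivariant_pairing_tensor:
  obtains act \<kappa> where "equivariant_pairing G (tensor_square G) (tensor G) act \<kappa>"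
proof -
  have "\<exists>F. F \<in> hom (tensor_square G) (tensor_square G) \<and> (\<forall>x\<in>carrier G. \<forall>y\<in>carrier G.
    F (tensor G x y) = tensor G (gconj G x h) (gconj G y h))" if "h \<in> carrier G" for h
    using tensor_lift[OF group_tensor_square crossed_pairing_gconj[OF crossed_pairing_tensor that]]
    by metis
  then obtain act where act: "\<And>h. h \<in> carrier G \<Longrightarrow> act h \<in> hom (tensor_square G) (tensor_square G) \<and>
    (\<forall>x\<in>carrier G. \<forall>y\<in>carrier G. act h (tensor G x y) = tensor G (gconj G x h) (gconj G y h))"
    by metis
  obtain \<kappa> where \<kappa>: "\<kappa> \<in> hom (tensor_square G) G"
    "\<And>x y. x \<in> carrier G \<Longrightarrow> y \<in> carrier G \<Longrightarrow> \<kappa> (tensor G x y) = group_commutator G x y"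
    using tensor_lift[OF group_axioms crossed_pairing_group_commutator] by metis
  have "equivariant_pairing G (tensor_square G) (tensor G) act \<kappa>"
    using group_axioms group_tensor_square crossed_pairing_tensor tensor_generators act \<kappa>
    by (intro equivariant_pairing.intro equivariant_pairing_axioms.intro) simp_all
  then show ?thesis by (rule that)
qed

end

section \<open>The group \<open>\<nu>(H)\<close>\<close>

text \<open>
  The relations of \<open>\<nu>(H)\<close> for two homomorphisms into an arbitrary group. Besides the two canonical maps
  into \<open>\<nu>(H)\<close> this covers the pairs of identity and trivial maps of \<open>H\<close> that define homomorphisms from
  \<open>\<nu>(H)\<close> back to \<open>H\<close>.
\<close>

locale compatible_copies = H: group H + G: group G
  for H :: "('a, 'b) monoid_scheme" (structure) and G :: "('g, 'h) monoid_scheme" +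
  fixes a b :: "'a \<Rightarrow> 'g"
  assumes a_hom: "a \<in> hom H G" and b_hom: "b \<in> hom H G"
    and conj_a: "\<And>x y z. x \<in> carrier H \<Longrightarrow> y \<in> carrier H \<Longrightarrow> z \<in> carrier H \<Longrightarrow>
      gconj G (group_commutator G (a x) (b y)) (a z) =
      group_commutator G (a (gconj H x z)) (b (gconj H y z))"
    and conj_b: "\<And>x y z. x \<in> carrier H \<Longrightarrow> y \<in> carrier H \<Longrightarrow> z \<in> carrier H \<Longrightarrow>
      gconj G (group_commutator G (a x) (b y)) (b z) =
      group_commutator G (a (gconj H x z)) (b (gconj H y z))"
begin

sublocale a: group_hom H G a by unfold_locales (rule a_hom)
sublocale b: group_hom H G b by unfold_locales (rule b_hom)

lemma crossed_pairing_copies: "crossed_pairing H G (\<lambda>x y. group_commutator G (a x) (b y))"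
  by (simp add: crossed_pairing_def G.group_commutator_mult_left G.group_commutator_mult_right
      conj_a conj_b)

text \<open>
  On the image of \<open>T\<close> the two copies of \<open>H\<close> act by conjugation in the same way, because they do so on
  the generators \<open>[a x, b y]\<close>; this is what links centrality in \<open>G\<close> to the action of \<open>H\<close> on \<open>T\<close>.
\<close>

lemma gconj_in_image:
  assumes eq: "equivariant_pairing H T \<tau> act \<kappa>" and \<phi>: "\<phi> \<in> hom T G"
    "\<And>x y. x \<in> carrier H \<Longrightarrow> y \<in> carrier H \<Longrightarrow> \<phi> (\<tau> x y) = group_commutator G (a x) (b y)"
    and th: "t \<in> carrier T" "h \<in> carrier H"
  shows "gconj G (\<phi> t) (a h) = \<phi> (act h t)" "gconj G (\<phi> t) (b h) = \<phi> (act h t)"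
proof -
  interpret equivariant_pairing H T \<tau> act \<kappa> by (rule eq)
  have act: "(\<lambda>t. \<phi> (act h t)) \<in> hom T G"
    using hom_compose[OF act_hom[OF th(2)] \<phi>(1)] by (simp add: comp_def)
  have conj: "(\<lambda>t. gconj G (\<phi> t) g) \<in> hom T G" if "g \<in> carrier G" for g
    using hom_compose[OF \<phi>(1) G.gconj_hom[OF that]] by (simp add: comp_def)
  show "gconj G (\<phi> t) (a h) = \<phi> (act h t)"
    by (rule hom_eqI[where f = "\<lambda>t. gconj G (\<phi> t) (a h)" and g = "\<lambda>t. \<phi> (act h t)",
          OF G.group_axioms conj act _ th(1)])
      (simp_all add: th \<phi>(2) conj_a act_\<tau>)
  show "gconj G (\<phi> t) (b h) = \<phi> (act h t)"
    by (rule hom_eqI[where f = "\<lambda>t. gconj G (\<phi> t) (b h)" and g = "\<lambda>t. \<phi> (act h t)",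
          OF G.group_axioms conj act _ th(1)])
      (simp_all add: th \<phi>(2) conj_b act_\<tau>)
qed

end

text \<open>
  Modulo \<open>U\<close> the images of \<open>a\<close> and \<open>b\<close> commute, so every \<open>g\<close> is congruent to \<open>a (p g) b (q g)\<close>: both sides
  are homomorphisms in \<open>g\<close> to the quotient, and they agree on the generators.
\<close>

lemma (in compatible_copies) in_normal_subgroup_if_projections_trivial:
  assumes U: "U \<lhd> G"
    and comm: "\<And>x y. x \<in> carrier H \<Longrightarrow> y \<in> carrier H \<Longrightarrow> group_commutator G (a x) (b y) \<in> U"
    and generated: "generate G (a ` carrier H \<union> b ` carrier H) = carrier G"
    and p_hom: "p \<in> hom G H" and q_hom: "q \<in> hom G H"
    and p: "\<And>h. h \<in> carrier H \<Longrightarrow> p (a h) = h" "\<And>h. h \<in> carrier H \<Longrightarrow> p (b h) = \<one>"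
    and q: "\<And>h. h \<in> carrier H \<Longrightarrow> q (a h) = \<one>" "\<And>h. h \<in> carrier H \<Longrightarrow> q (b h) = h"
    and z: "z \<in> carrier G" "p z = \<one>" "q z = \<one>"
  shows "z \<in> U"
proof -
  interpret U: normal U G by (rule U)
  interpret p: group_hom G H p by unfold_locales (rule p_hom)
  interpret q: group_hom G H q by unfold_locales (rule q_hom)
  define Q where "Q = G Mod U"
  define \<pi> where "\<pi> g = U #>\<^bsub>G\<^esub> g" for g
  interpret Q: group Q unfolding Q_def by (rule U.factorgroup_is_group)
  interpret \<pi>: group_hom G Q \<pi>
    by unfold_locales (simp add: Q_def \<pi>_def [abs_def] U.r_coset_hom_Mod del: mult_FactGroup)
  have \<pi>_U: "\<pi> g = \<one>\<^bsub>Q\<^esub> \<longleftrightarrow> g \<in> U" if "g \<in> carrier G" for g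
    using G.coset_join1[OF _ that U.subgroup_axioms] G.coset_join2[OF that U.subgroup_axioms]
    by (auto simp: \<pi>_def Q_def)
  have \<pi>_comm: "\<pi> (b y) \<otimes>\<^bsub>Q\<^esub> \<pi> (a x) = \<pi> (a x) \<otimes>\<^bsub>Q\<^esub> \<pi> (b y)"
    if "x \<in> carrier H" "y \<in> carrier H" for x y
  proof -
    have "\<pi> (group_commutator G (a x) (b y)) = \<one>\<^bsub>Q\<^esub>"
      using \<pi>_U comm that by simp
    then have "\<pi> (b y \<otimes>\<^bsub>G\<^esub> a x \<otimes>\<^bsub>G\<^esub> group_commutator G (a x) (b y)) = \<pi> (b y) \<otimes>\<^bsub>Q\<^esub> \<pi> (a x)"
      using that by simp
    moreover have "b y \<otimes>\<^bsub>G\<^esub> a x \<otimes>\<^bsub>G\<^esub> group_commutator G (a x) (b y) = a x \<otimes>\<^bsub>G\<^esub> b y"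
      using that by (simp add: group_commutator_def G.m_assoc)
    ultimately show ?thesis using that by simp
  qed
  have "\<pi> z = \<pi> (a (p z)) \<otimes>\<^bsub>Q\<^esub> \<pi> (b (q z))"
  proof (rule hom_eq_on_generate[OF G.group_axioms Q.group_axioms \<pi>.homh])
    show "(\<lambda>g. \<pi> (a (p g)) \<otimes>\<^bsub>Q\<^esub> \<pi> (b (q g))) \<in> hom G Q"
    proof (rule homI)
      fix g h assume gh: "g \<in> carrier G" "h \<in> carrier G"
      have "\<pi> (b (q g)) \<otimes>\<^bsub>Q\<^esub> (\<pi> (a (p h)) \<otimes>\<^bsub>Q\<^esub> \<pi> (b (q h))) =
        \<pi> (a (p h)) \<otimes>\<^bsub>Q\<^esub> (\<pi> (b (q g)) \<otimes>\<^bsub>Q\<^esub> \<pi> (b (q h)))"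
        using gh \<pi>_comm[of "p h" "q g"] by (simp flip: Q.m_assoc)
      then show "\<pi> (a (p (g \<otimes>\<^bsub>G\<^esub> h))) \<otimes>\<^bsub>Q\<^esub> \<pi> (b (q (g \<otimes>\<^bsub>G\<^esub> h))) =
        \<pi> (a (p g)) \<otimes>\<^bsub>Q\<^esub> \<pi> (b (q g)) \<otimes>\<^bsub>Q\<^esub> (\<pi> (a (p h)) \<otimes>\<^bsub>Q\<^esub> \<pi> (b (q h)))"
        using gh by (simp add: Q.m_assoc)
    qed simp
    show "z \<in> generate G (a ` carrier H \<union> b ` carrier H)" using z(1) generated by simp
  qed (auto simp: p q)
  then show ?thesis using \<pi>_U[OF z(1)] z by simp
qed

text \<open>
  The subgroup \<open>U\<close> generated by the \<open>[a x, b y]\<close> is the image of the tensor square under \<open>\<phi>\<close>. An element \<open>z\<close> in the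
  kernels of \<open>p\<close>, \<open>q\<close> and \<open>r\<close> lies in \<open>U\<close>, so \<open>z = \<phi> t\<close>, and \<open>\<kappa> t = r z = \<one>\<close>. Hence \<open>H\<close> fixes \<open>t\<close>, which says that
  \<open>z\<close> commutes with both copies of \<open>H\<close>. So the common kernel is central.
\<close>

theorem (in compatible_copies) polycyclic_by_finite:
  assumes H: "polycyclic_by_finite H"
    and generated: "generate G (a ` carrier H \<union> b ` carrier H) = carrier G"
    and p_hom: "p \<in> hom G H" and q_hom: "q \<in> hom G H" and r_hom: "r \<in> hom G H"
    and p: "\<And>h. h \<in> carrier H \<Longrightarrow> p (a h) = h" "\<And>h. h \<in> carrier H \<Longrightarrow> p (b h) = \<one>"
    and q: "\<And>h. h \<in> carrier H \<Longrightarrow> q (a h) = \<one>" "\<And>h. h \<in> carrier H \<Longrightarrow> q (b h) = h"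
    and r: "\<And>h. h \<in> carrier H \<Longrightarrow> r (a h) = h" "\<And>h. h \<in> carrier H \<Longrightarrow> r (b h) = h"
  shows "polycyclic_by_finite G"
proof -
  let ?T = "tensor_square H"
  obtain act \<kappa> where eq: "equivariant_pairing H ?T (tensor H) act \<kappa>"
    by (rule H.equivariant_pairing_tensor)
  interpret E: equivariant_pairing H ?T "tensor H" act \<kappa> by (rule eq)
  obtain \<phi> where \<phi>: "\<phi> \<in> hom ?T G"
    "\<And>x y. x \<in> carrier H \<Longrightarrow> y \<in> carrier H \<Longrightarrow> \<phi> (tensor H x y) = group_commutator G (a x) (b y)"
    using H.tensor_lift[OF G.group_axioms crossed_pairing_copies] by metis
  have conj: "gconj G (\<phi> t) (a h) = \<phi> (act h t)" "gconj G (\<phi> t) (b h) = \<phi> (act h t)"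
    if "t \<in> carrier ?T" "h \<in> carrier H" for t h
    using gconj_in_image[OF eq \<phi>(1) \<phi>(2)] that by simp_all
  interpret \<phi>: group_hom ?T G \<phi> by unfold_locales (rule \<phi>(1))
  interpret r: group_hom G H r by unfold_locales (rule r_hom)
  let ?X = "a ` carrier H \<union> b ` carrier H"
  have X: "?X \<subseteq> carrier G" by auto
  let ?U = "\<phi> ` carrier ?T"
  have U: "subgroup ?U G" by (rule \<phi>.img_is_subgroup)
  have conj_U: "gconj G u x \<in> ?U" if "u \<in> ?U" "x \<in> ?X" for u x
    using that by (auto simp: conj)
  have inv_X: "inv\<^bsub>G\<^esub> x \<in> ?X" if "x \<in> ?X" for x
    using that by (auto simp flip: a.hom_inv b.hom_inv)
  have "\<forall>u\<in>?U. gconj G u g \<in> ?U" if "g \<in> generate G ?X" for g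
    using that
  proof (induction rule: generate.induct)
    case (eng g h)
    then have "g \<in> carrier G" "h \<in> carrier G" using generated by auto
    then show ?case using eng by (auto simp flip: G.gconj_gconj)
  qed (use conj_U inv_X in auto)
  then have "gconj G u g \<in> ?U" if "g \<in> carrier G" "u \<in> ?U" for g u
    using generated that by blast
  then have "g \<otimes>\<^bsub>G\<^esub> u \<otimes>\<^bsub>G\<^esub> inv\<^bsub>G\<^esub> g \<in> ?U" if "g \<in> carrier G" "u \<in> ?U" for g u
    using that(2) G.inv_closed[OF that(1)] that(1) unfolding gconj_def by (metis G.inv_inv)
  then have "?U \<lhd> G" using U by (intro G.normal_invI) auto
  then have in_U: "z \<in> ?U" if "z \<in> carrier G" "p z = \<one>" "q z = \<one>" for z
  proof (rule in_normal_subgroup_if_projections_trivial[OF _ _ generated p_hom q_hom p q that])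
    show "group_commutator G (a x) (b y) \<in> ?U" if "x \<in> carrier H" "y \<in> carrier H" for x y
      using \<phi>(2)[OF that] that by (intro image_eqI[of _ _ "tensor H x y"]) auto
  qed
  have r_\<phi>: "r (\<phi> t) = \<kappa> t" if "t \<in> carrier ?T" for t
  proof (rule E.hom_eqI[where f = "\<lambda>t. r (\<phi> t)" and g = \<kappa>, OF H.group_axioms _ E.\<kappa>_hom _ that])
    show "(\<lambda>t. r (\<phi> t)) \<in> hom ?T H"
      using hom_compose[OF \<phi>(1) r_hom] by (simp add: comp_def)
    show "r (\<phi> (tensor H x y)) = \<kappa> (tensor H x y)" if "x \<in> carrier H" "y \<in> carrier H" for x y
      using that by (simp add: \<phi>(2) E.\<kappa>_\<tau> group_commutator_def r)
  qed
  have central: "z \<otimes>\<^bsub>G\<^esub> g = g \<otimes>\<^bsub>G\<^esub> z"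
    if z: "z \<in> carrier G" "p z = \<one>" "q z = \<one>" "r z = \<one>" and g: "g \<in> carrier G" for z g
  proof -
    have "z \<in> ?U" by (rule in_U[OF z(1-3)])
    then obtain t where t: "t \<in> carrier ?T" "z = \<phi> t" by blast
    then have "\<kappa> t = \<one>" using r_\<phi> z(4) by simp
    then have fixed: "gconj G z (a h) = z" "gconj G z (b h) = z" if "h \<in> carrier H" for h
      using conj[OF t(1) that] E.kernel_fixed[OF t(1) _ that] t(2) by simp_all
    have comm: "gconj G x z = x" if x: "x \<in> ?X" for x
    proof -
      have xc: "x \<in> carrier G" using x X by blast
      have "gconj G z x = z" using x fixed by auto
      then have "x \<otimes>\<^bsub>G\<^esub> gconj G z x = x \<otimes>\<^bsub>G\<^esub> z" by simp
      then have "z \<otimes>\<^bsub>G\<^esub> x = x \<otimes>\<^bsub>G\<^esub> z" using xc z(1) by (simp add: G.mult_gconj_eq)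
      then have "inv\<^bsub>G\<^esub> z \<otimes>\<^bsub>G\<^esub> (x \<otimes>\<^bsub>G\<^esub> z) = inv\<^bsub>G\<^esub> z \<otimes>\<^bsub>G\<^esub> (z \<otimes>\<^bsub>G\<^esub> x)" by simp
      then show ?thesis using xc z(1) by (simp add: gconj_def G.m_assoc)
    qed
    have "gconj G g z = g"
    proof (rule hom_eq_on_generate[OF G.group_axioms G.group_axioms G.gconj_hom[OF z(1)] _ X comm])
      show "(\<lambda>x. x) \<in> hom G G" by (simp add: hom_def)
      show "g \<in> generate G ?X" using g generated by simp
    qed
    then show ?thesis using G.mult_gconj_eq[OF g z(1)] by simp
  qed
  obtain Y where Y: "finite Y" "Y \<subseteq> carrier H" "generate H Y = carrier H"
    using H.subgroup_finitely_generated[OF H H.subgroup_self] by metis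
  let ?Y = "a ` Y \<union> b ` Y"
  have Yc: "?Y \<subseteq> carrier G" using Y(2) by auto
  have "generate G ?Y = carrier G"
  proof
    show "generate G ?Y \<subseteq> carrier G" by (rule G.generate_incl[OF Yc])
    have "a ` carrier H = generate G (a ` Y)" "b ` carrier H = generate G (b ` Y)"
      using a.generate_img[OF Y(2)] b.generate_img[OF Y(2)] Y(3) by simp_all
    moreover have "generate G (a ` Y) \<subseteq> generate G ?Y" "generate G (b ` Y) \<subseteq> generate G ?Y"
      by (rule G.mono_generate, blast)+
    ultimately have "?X \<subseteq> generate G ?Y" by simp
    then have "generate G ?X \<subseteq> generate G ?Y"
      by (rule G.generate_subgroup_incl[OF _ G.generate_is_subgroup[OF Yc]])
    then show "carrier G \<subseteq> generate G ?Y" by (simp only: generated)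
  qed
  with Y(1) Yc show ?thesis
  proof (intro G.polycyclic_by_finite_if_central_kernel[of ?Y H "{p, q, r}"])
    show "z \<otimes>\<^bsub>G\<^esub> g = g \<otimes>\<^bsub>G\<^esub> z"
      if "z \<in> carrier G" "\<And>f. f \<in> {p, q, r} \<Longrightarrow> f z = \<one>" "g \<in> carrier G" for z g
      using that by (intro central) auto
  qed (use H H.group_axioms p_hom q_hom r_hom in auto)
qed

definition nu_class :: "('a, 'b) monoid_scheme \<Rightarrow> 'a + 'a \<Rightarrow> ('a + 'a) word set"
  where "nu_class H s = word_class (Inl ` carrier H \<union> Inr ` carrier H)
    (free_product_relations H \<union> nu_relations H) (gen s)"

context group
begin

lemma group_nu_group: "group (nu_group G)"
  unfolding nu_group_def by (rule group_presented_group)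

lemma nu_generators:
  "generate (nu_group G) ((\<lambda>h. nu_class G (Inl h)) ` carrier G \<union> (\<lambda>h. nu_class G (Inr h)) ` carrier G) =
    carrier (nu_group G)"
proof -
  have "(\<lambda>h. nu_class G (Inl h)) ` carrier G \<union> (\<lambda>h. nu_class G (Inr h)) ` carrier G =
    nu_class G ` (Inl ` carrier G \<union> Inr ` carrier G)"
    by (simp add: image_Un image_image)
  then show ?thesis
    by (simp only: nu_group_def nu_class_def [abs_def] presented_group_generators)
qed

lemma compatible_copies_nu:
  "compatible_copies G (nu_group G) (\<lambda>h. nu_class G (Inl h)) (\<lambda>h. nu_class G (Inr h))"
proof -
  let ?S = "Inl ` carrier G \<union> Inr ` carrier G" and ?R = "free_product_relations G \<union> nu_relations G"
  let ?c = "nu_class G" and ?N = "nu_group G"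
  interpret N: group ?N by (rule group_nu_group)
  have c: "?c \<in> ?S \<rightarrow> carrier ?N"
    by (auto simp: nu_class_def nu_group_def carrier_presented_group)
  have e: "word_eval ?N ?c (left_gen h) = ?c (Inl h)" "word_eval ?N ?c (psi_gen h) = ?c (Inr h)"
    if "h \<in> carrier G" for h
    using c that by (auto intro!: N.word_eval_gen)
  have rel: "word_eval ?N ?c u = word_eval ?N ?c v" if "(u, v) \<in> ?R" "u \<in> words ?S" "v \<in> words ?S" for u v
    using presented_group_relation[OF that] by (simp only: nu_group_def nu_class_def [abs_def])
  have mult: "?c (Inl (x \<otimes> y)) = ?c (Inl x) \<otimes>\<^bsub>?N\<^esub> ?c (Inl y)"
    "?c (Inr (x \<otimes> y)) = ?c (Inr x) \<otimes>\<^bsub>?N\<^esub> ?c (Inr y)"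
    if xy: "x \<in> carrier G" "y \<in> carrier G" for x y
  proof -
    have "(left_gen (x \<otimes> y), left_gen x @ left_gen y) \<in> ?R" "(psi_gen (x \<otimes> y), psi_gen x @ psi_gen y) \<in> ?R"
      using xy unfolding free_product_relations_def by blast+
    then show "?c (Inl (x \<otimes> y)) = ?c (Inl x) \<otimes>\<^bsub>?N\<^esub> ?c (Inl y)"
      "?c (Inr (x \<otimes> y)) = ?c (Inr x) \<otimes>\<^bsub>?N\<^esub> ?c (Inr y)"
      using xy rel[of "left_gen (x \<otimes> y)" "left_gen x @ left_gen y"]
        rel[of "psi_gen (x \<otimes> y)" "psi_gen x @ psi_gen y"]
      by (simp_all add: e N.word_eval_append[OF c])
  qed
  have conj: "gconj ?N (group_commutator ?N (?c (Inl x)) (?c (Inr y))) (?c (Inr z)) =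
      gconj ?N (group_commutator ?N (?c (Inl x)) (?c (Inr y))) (?c (Inl z))"
    "gconj ?N (group_commutator ?N (?c (Inl x)) (?c (Inr y))) (?c (Inl z)) =
      group_commutator ?N (?c (Inl (gconj G x z))) (?c (Inr (gconj G y z)))"
    if xyz: "x \<in> carrier G" "y \<in> carrier G" "z \<in> carrier G" for x y z
  proof -
    have "(word_conj (word_comm (left_gen x) (psi_gen y)) (psi_gen z),
        word_conj (word_comm (left_gen x) (psi_gen y)) (left_gen z)) \<in> ?R"
      "(word_conj (word_comm (left_gen x) (psi_gen y)) (left_gen z),
        word_comm (left_gen (gconj G x z)) (psi_gen (gconj G y z))) \<in> ?R"
      using xyz unfolding nu_relations_def by blast+
    from this[THEN rel] xyz
    show "gconj ?N (group_commutator ?N (?c (Inl x)) (?c (Inr y))) (?c (Inr z)) =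
      gconj ?N (group_commutator ?N (?c (Inl x)) (?c (Inr y))) (?c (Inl z))"
    "gconj ?N (group_commutator ?N (?c (Inl x)) (?c (Inr y))) (?c (Inl z)) =
      group_commutator ?N (?c (Inl (gconj G x z))) (?c (Inr (gconj G y z)))"
      by (simp_all add: e N.word_eval_word_conj[OF c] N.word_eval_word_comm[OF c])
  qed
  show ?thesis
  proof
    show "(\<lambda>h. ?c (Inl h)) \<in> hom G ?N" "(\<lambda>h. ?c (Inr h)) \<in> hom G ?N"
      using c mult by (auto simp: hom_def)
  qed (use conj in simp_all)
qed

lemma nu_lift:
  assumes copies: "compatible_copies G K \<alpha> \<beta>"
  obtains F where "F \<in> hom (nu_group G) K"
    "\<And>h. h \<in> carrier G \<Longrightarrow> F (nu_class G (Inl h)) = \<alpha> h"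
    "\<And>h. h \<in> carrier G \<Longrightarrow> F (nu_class G (Inr h)) = \<beta> h"
proof -
  interpret compatible_copies G K \<alpha> \<beta> by (rule copies)
  let ?S = "Inl ` carrier G \<union> Inr ` carrier G" and ?R = "free_product_relations G \<union> nu_relations G"
  let ?\<phi> = "case_sum \<alpha> \<beta>"
  have \<phi>: "?\<phi> \<in> ?S \<rightarrow> carrier K" by auto
  have e: "word_eval K ?\<phi> (left_gen h) = \<alpha> h" "word_eval K ?\<phi> (psi_gen h) = \<beta> h" if "h \<in> carrier G" for h
    using that by (simp_all add: G.word_eval_gen)
  have "word_eval K ?\<phi> u = word_eval K ?\<phi> v" if "(u, v) \<in> ?R" for u v
    using that unfolding free_product_relations_def nu_relations_def
    by (auto simp: e G.word_eval_append[OF \<phi>] G.word_eval_word_conj[OF \<phi>] G.word_eval_word_comm[OF \<phi>]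
        conj_a conj_b)
  then obtain F where "F \<in> hom (presented_group ?S ?R) K"
    "\<And>x. x \<in> ?S \<Longrightarrow> F (word_class ?S ?R (gen x)) = ?\<phi> x"
    using presented_group_lift[OF G.group_axioms \<phi>, of ?R] by metis
  then show ?thesis using that[of F] by (auto simp: nu_group_def nu_class_def)
qed

end

theorem corollary1:
  fixes H :: "('a, 'b) monoid_scheme"
  assumes "group H"
    and "polycyclic_by_finite H"
  shows "polycyclic_by_finite (nu_group H) \<and> polycyclic_by_finite (tensor_square H)"
proof
  interpret group H by (rule assms(1))
  obtain act \<kappa> where "equivariant_pairing H (tensor_square H) (tensor H) act \<kappa>"
    by (rule equivariant_pairing_tensor)
  then show "polycyclic_by_finite (tensor_square H)"
    using assms(2) by (rule equivariant_pairing.polycyclic_by_finite)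
  \<comment> \<open>The projections p and q come from those of the free product onto its factors.\<close>
  have "compatible_copies H H (\<lambda>h. h) (\<lambda>h. \<one>\<^bsub>H\<^esub>)"
    by unfold_locales (auto simp: hom_def group_commutator_def)
  then obtain p where p: "p \<in> hom (nu_group H) H"
    "\<And>h. h \<in> carrier H \<Longrightarrow> p (nu_class H (Inl h)) = h"
    "\<And>h. h \<in> carrier H \<Longrightarrow> p (nu_class H (Inr h)) = \<one>\<^bsub>H\<^esub>"
    using nu_lift by metis
  have "compatible_copies H H (\<lambda>h. \<one>\<^bsub>H\<^esub>) (\<lambda>h. h)"
    by unfold_locales (auto simp: hom_def group_commutator_def)
  then obtain q where q: "q \<in> hom (nu_group H) H"
    "\<And>h. h \<in> carrier H \<Longrightarrow> q (nu_class H (Inl h)) = \<one>\<^bsub>H\<^esub>"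
    "\<And>h. h \<in> carrier H \<Longrightarrow> q (nu_class H (Inr h)) = h"
    using nu_lift by metis
  \<comment> \<open>The folding map, which restricts to the commutator map on the subgroup of mixed commutators.\<close>
  have "compatible_copies H H (\<lambda>h. h) (\<lambda>h. h)"
    by unfold_locales (auto simp: hom_def gconj_group_commutator)
  then obtain r where r: "r \<in> hom (nu_group H) H"
    "\<And>h. h \<in> carrier H \<Longrightarrow> r (nu_class H (Inl h)) = h"
    "\<And>h. h \<in> carrier H \<Longrightarrow> r (nu_class H (Inr h)) = h"
    using nu_lift by metis
  show "polycyclic_by_finite (nu_group H)"
    by (rule compatible_copies.polycyclic_by_finite[OF compatible_copies_nu assms(2) nu_generators
          p(1) q(1) r(1) p(2,3) q(2,3) r(2,3)])
qed

end
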